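(* Let $J$ be an at most countable set of indices, let $\mathcal T_j=(V_j,p_j)$, $j\in J$, be a family of pairwise disjoint rooted directed trees, with $\omega_j$ denoting the root of $\mathcal T_j$, and let $\{\lambda_v\}_{v\in\bigcup_{j\in J}V_j}$ be complex numbers such that for every $j\in J$ the weighted shift $S_j$ on $\mathcal T_j$ with weights $\lambda_v$ at $v\in V_j\setminus\{\omega_j\}$ and weight $0$ at $\omega_j$ is proper and bounded. Then the following conditions are equivalent: (a) the weights $\{\tilde\lambda_{\omega_j}\}_{j\in J}$ can be chosen such that $S_{\tilde\lambda}$ is a proper (bounded) power hyponormal weighted shift on the rooted sum of the family $\{\mathcal T_j\}_{j\in J}$ (with vertex set $V_J=\{\omega\}\sqcup\bigsqcup_{j\in J}V_j$ and root $\omega$), where $\tilde\lambda=\{\tilde\lambda_v\}_{v\in V_J}$, $\tilde\lambda_\omega=0$, and $\tilde\lambda_v=\lambda_v$ for $v\in V_j\setminus\{\omega_j\}$, $j\in J$; (b) $\sup\{\|S_j\|:j\in J\}<\infty$ and for every $j\in J$ the weighted shift $S_j$ on $\mathcal T_j$ admits power hyponormal $1$-step backward extension.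
   Context: A directed forest is a pair $\mathcal T=(V,p)$ where $V$ is a nonempty set and $p:V\to V$ is a function such that $p^n(v)=v$ with $n\ge 1$ implies $p(v)=v$. Roots are the $v$ with $p(v)=v$. A tree in $\mathcal T$ is an equivalence class of the relation $v\sim w\iff \exists m,n\ge 0:\ p^n(v)=p^m(w)$; a directed tree is a directed forest with exactly one tree; it has at most one root, and is called a rooted directed tree if it has one. A system of weights on $\mathcal T$ is $\lambda=\{\lambda_v\}_{v\in V}\subseteq\mathbb C$ with $\lambda_v=0$ for every root $v$. The weighted shift $S_\lambda$ on $\mathcal T$ is the operator in $\ell^2(V)$ given by $(S_\lambda f)(v)=\lambda_v f(p(v))$ (with maximal domain). It is proper if $\lambda_v=0$ only for roots $v$. All weighted shifts here are bounded operators on $\ell^2(V)$. A bounded operator $T$ is hyponormal if $T^*T-TT^*\ge0$, and power hyponormal if $T^n$ is hyponormal for all $n\ge1$. Rooted sum: for pairwise disjoint rooted directed trees $\mathcal T_j=(V_j,p_j)$ with roots $\omega_j$ it is the directed tree $(V_J,p_J)$, $V_J=\{\omega\}\sqcup\bigsqcup_{j}V_j$ ($\omega$ a new vertex), $p_J(v)=p_j(v)$ for $v\in V_j\setminus\{\omega_j\}$, and $p_J(v)=\omega$ otherwise (so $p_J(\omega_j)=\omega$, $p_J(\omega)=\omega$). 1-step backward extension: for a rooted directed tree $\mathcal T=(V,p)$ with root $\omega_0$, $\mathcal T_{\langle 1\rangle}$ is the directed tree with vertex set $V\sqcup\{\omega_1\}$ and parent function equal to $p$ on $V\setminus\{\omega_0\}$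 and sending $\omega_0$ and $\omega_1$ to $\omega_1$. A bounded weighted shift $S_\lambda$ on $\mathcal T$ admits power hyponormal $1$-step backward extension if it is power hyponormal and there exists a nonzero weight $\lambda'_{\omega_0}$ such that the weighted shift on $\mathcal T_{\langle1\rangle}$ with weights $\lambda'_v=\lambda_v$ for $v\in V\setminus\{\omega_0\}$, $\lambda'_{\omega_0}$ at $\omega_0$, and $0$ at $\omega_1$, is bounded and power hyponormal. *)

theory Defs
  imports "HOL-Analysis.Analysis"
begin

definition directed_forest :: "'a set \<Rightarrow> ('a \<Rightarrow> 'a) \<Rightarrow> bool" where
  "directed_forest V p \<longleftrightarrow> V \<noteq> {} \<and> p \<in> V \<rightarrow> V \<and>
     (\<forall>v\<in>V. \<forall>n\<ge>1. (p ^^ n) v = v \<longrightarrow> p v = v)"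

definition is_root :: "'a set \<Rightarrow> ('a \<Rightarrow> 'a) \<Rightarrow> 'a \<Rightarrow> bool" where
  "is_root V p v \<longleftrightarrow> v \<in> V \<and> p v = v"

definition same_tree :: "'a set \<Rightarrow> ('a \<Rightarrow> 'a) \<Rightarrow> ('a \<times> 'a) set" where
  "same_tree V p = {(v, w). v \<in> V \<and> w \<in> V \<and> (\<exists>m n. (p ^^ n) v = (p ^^ m) w)}"

definition directed_tree :: "'a set \<Rightarrow> ('a \<Rightarrow> 'a) \<Rightarrow> bool" where
  "directed_tree V p \<longleftrightarrow> directed_forest V p \<and> (\<exists>!T. T \<in> V // same_tree V p)"

definition rooted_directed_tree :: "'a set \<Rightarrow> ('a \<Rightarrow> 'a) \<Rightarrow> bool" where
  "rooted_directed_tree V p \<longleftrightarrow> directed_tree V p \<and> (\<exists>w. is_root V p w)"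

definition tree_root :: "'a set \<Rightarrow> ('a \<Rightarrow> 'a) \<Rightarrow> 'a" where
  "tree_root V p = (THE w. is_root V p w)"

text \<open>Elements of \<open>\<ell>\<^sup>2(V)\<close> are represented by their extensions by zero to the whole type,
  so that equality of functions is equality of elements.\<close>

definition ell2 :: "'a set \<Rightarrow> ('a \<Rightarrow> complex) set" where
  "ell2 V = {f. (\<forall>v. v \<notin> V \<longrightarrow> f v = 0) \<and> (\<lambda>v. (cmod (f v))\<^sup>2) summable_on V}"

definition ell2_inner :: "'a set \<Rightarrow> ('a \<Rightarrow> complex) \<Rightarrow> ('a \<Rightarrow> complex) \<Rightarrow> complex" where
  "ell2_inner V f g = (\<Sum>\<^sub>\<infinity>v\<in>V. f v * cnj (g v))"

definition ell2_norm :: "'a set \<Rightarrow> ('a \<Rightarrow> complex) \<Rightarrow> real" where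
  "ell2_norm V f = sqrt (\<Sum>\<^sub>\<infinity>v\<in>V. (cmod (f v))\<^sup>2)"

text \<open>Operators are functions on \<^typ>\<open>'a \<Rightarrow> complex\<close>; only their values on \<^term>\<open>ell2 V\<close> matter.\<close>

definition bounded_operator ::
    "'a set \<Rightarrow> (('a \<Rightarrow> complex) \<Rightarrow> ('a \<Rightarrow> complex)) \<Rightarrow> bool" where
  "bounded_operator V T \<longleftrightarrow>
     T \<in> ell2 V \<rightarrow> ell2 V \<and>
     (\<forall>f\<in>ell2 V. \<forall>g\<in>ell2 V. T (\<lambda>v. f v + g v) = (\<lambda>v. T f v + T g v)) \<and>
     (\<forall>c. \<forall>f\<in>ell2 V. T (\<lambda>v. c * f v) = (\<lambda>v. c * T f v)) \<and>
     (\<exists>C. \<forall>f\<in>ell2 V. ell2_norm V (T f) \<le> C * ell2_norm V f)"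

definition op_norm :: "'a set \<Rightarrow> (('a \<Rightarrow> complex) \<Rightarrow> ('a \<Rightarrow> complex)) \<Rightarrow> real" where
  "op_norm V T = (SUP f\<in>{f \<in> ell2 V. ell2_norm V f \<le> 1}. ell2_norm V (T f))"

text \<open>For a bounded \<open>T\<close> and \<open>g\<close> in \<^term>\<open>ell2 V\<close> the vector described here exists and is unique
  (Riesz).\<close>

definition op_adjoint ::
    "'a set \<Rightarrow> (('a \<Rightarrow> complex) \<Rightarrow> ('a \<Rightarrow> complex)) \<Rightarrow> ('a \<Rightarrow> complex) \<Rightarrow> ('a \<Rightarrow> complex)" where
  "op_adjoint V T g =
     (THE h. h \<in> ell2 V \<and> (\<forall>f\<in>ell2 V. ell2_inner V (T f) g = ell2_inner V f h))"

definition positive_operator ::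
    "'a set \<Rightarrow> (('a \<Rightarrow> complex) \<Rightarrow> ('a \<Rightarrow> complex)) \<Rightarrow> bool" where
  "positive_operator V A \<longleftrightarrow> (\<forall>f\<in>ell2 V. ell2_inner V (A f) f \<in> \<real>\<^sub>\<ge>\<^sub>0)"

definition hyponormal ::
    "'a set \<Rightarrow> (('a \<Rightarrow> complex) \<Rightarrow> ('a \<Rightarrow> complex)) \<Rightarrow> bool" where
  "hyponormal V T \<longleftrightarrow> bounded_operator V T \<and>
     positive_operator V (\<lambda>f v. op_adjoint V T (T f) v - T (op_adjoint V T f) v)"

definition power_hyponormal ::
    "'a set \<Rightarrow> (('a \<Rightarrow> complex) \<Rightarrow> ('a \<Rightarrow> complex)) \<Rightarrow> bool" where
  "power_hyponormal V T \<longleftrightarrow> bounded_operator V T \<and> (\<forall>n\<ge>1. hyponormal V (T ^^ n))"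

definition weight_system :: "'a set \<Rightarrow> ('a \<Rightarrow> 'a) \<Rightarrow> ('a \<Rightarrow> complex) \<Rightarrow> bool" where
  "weight_system V p lam \<longleftrightarrow> (\<forall>v. is_root V p v \<longrightarrow> lam v = 0)"

definition proper_weights :: "'a set \<Rightarrow> ('a \<Rightarrow> 'a) \<Rightarrow> ('a \<Rightarrow> complex) \<Rightarrow> bool" where
  "proper_weights V p lam \<longleftrightarrow> (\<forall>v\<in>V. lam v = 0 \<longrightarrow> is_root V p v)"

definition weighted_shift ::
    "'a set \<Rightarrow> ('a \<Rightarrow> 'a) \<Rightarrow> ('a \<Rightarrow> complex) \<Rightarrow> ('a \<Rightarrow> complex) \<Rightarrow> ('a \<Rightarrow> complex)" where
  "weighted_shift V p lam f = (\<lambda>v. if v \<in> V then lam v * f (p v) else 0)"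

text \<open>The maximal domain of the shift is the set of \<open>f\<close> in \<^term>\<open>ell2 V\<close> whose image lies in
  \<^term>\<open>ell2 V\<close>; \<^const>\<open>bounded_operator\<close> says in particular that this is all of \<^term>\<open>ell2 V\<close>.\<close>

definition bounded_weighted_shift :: "'a set \<Rightarrow> ('a \<Rightarrow> 'a) \<Rightarrow> ('a \<Rightarrow> complex) \<Rightarrow> bool" where
  "bounded_weighted_shift V p lam \<longleftrightarrow>
     weight_system V p lam \<and> bounded_operator V (weighted_shift V p lam)"

text \<open>In both constructions \<^const>\<open>None\<close> is the new vertex and \<^const>\<open>Some\<close> embeds the old ones.\<close>

definition rooted_sum_vertices :: "'j set \<Rightarrow> ('j \<Rightarrow> 'a set) \<Rightarrow> 'a option set" where
  "rooted_sum_vertices J V = insert None (Some ` (\<Union>j\<in>J. V j))"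

text \<open>For disjoint trees the index \<open>j\<close> below is the one of the tree containing \<open>v\<close>.\<close>

definition rooted_sum_parent ::
    "'j set \<Rightarrow> ('j \<Rightarrow> 'a set) \<Rightarrow> ('j \<Rightarrow> 'a \<Rightarrow> 'a) \<Rightarrow> 'a option \<Rightarrow> 'a option" where
  "rooted_sum_parent J V p x =
     (case x of
        None \<Rightarrow> None
      | Some v \<Rightarrow>
          (let j = (THE j. j \<in> J \<and> v \<in> V j)
           in if v = tree_root (V j) (p j) then None else Some (p j v)))"

definition backward_ext_vertices :: "'a set \<Rightarrow> 'a option set" where
  "backward_ext_vertices V = insert None (Some ` V)"

definition backward_ext_parent :: "'a set \<Rightarrow> ('a \<Rightarrow> 'a) \<Rightarrow> 'a option \<Rightarrow> 'a option" where
  "backward_ext_parent V p x =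
     (case x of
        None \<Rightarrow> None
      | Some v \<Rightarrow> if v = tree_root V p then None else Some (p v))"

definition backward_ext_weights ::
    "'a set \<Rightarrow> ('a \<Rightarrow> 'a) \<Rightarrow> ('a \<Rightarrow> complex) \<Rightarrow> complex \<Rightarrow> 'a option \<Rightarrow> complex" where
  "backward_ext_weights V p lam c x =
     (case x of
        None \<Rightarrow> 0
      | Some v \<Rightarrow> if v = tree_root V p then c else lam v)"

definition admits_power_hyponormal_backward_ext ::
    "'a set \<Rightarrow> ('a \<Rightarrow> 'a) \<Rightarrow> ('a \<Rightarrow> complex) \<Rightarrow> bool" where
  "admits_power_hyponormal_backward_ext V p lam \<longleftrightarrow>
     bounded_weighted_shift V p lam \<and>
     power_hyponormal V (weighted_shift V p lam) \<and>
     (\<exists>c. c \<noteq> 0 \<and>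
        (let V1 = backward_ext_vertices V;
             p1 = backward_ext_parent V p;
             lam1 = backward_ext_weights V p lam c
         in bounded_weighted_shift V1 p1 lam1 \<and>
            power_hyponormal V1 (weighted_shift V1 p1 lam1)))"

end

theory Submission
  imports Defs
begin

text \<open>
  Hyponormality of a bounded \<open>T\<close> amounts to
  \<open>2 Re \<langle>Tg, f\<rangle> \<le> \<parallel>g\<parallel>\<^sup>2 + \<parallel>Tf\<parallel>\<^sup>2\<close> for all \<open>f\<close> and \<open>g\<close>. This form does not mention
  the adjoint and is additive over disjoint supports. Powers of the shift on the rooted sum agree
  on \<open>V\<^sub>j\<close> with powers of the shift on the one-step extension of the \<open>j\<close>-th tree, provided
  that the value at the new root is rescaled by the ratio of the two weights at \<open>\<omega>\<^sub>j\<close>. Given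
  the sum, each extension uses the weight at \<open>\<omega>\<^sub>j\<close> itself (ratio 1) and the inequality restricts.
  Conversely, extension weights \<open>c\<^sub>j\<close> are multiplied by positive \<open>e\<^sub>j\<close> so small that
  \<open>\<Sum>e\<^sub>j\<^sup>2 \<le> 1\<close> and \<open>\<Sum>(e\<^sub>j\<bar>c\<^sub>j\<bar>)\<^sup>2\<close> converges; summing the inequalities over \<open>j\<close>, the contributions of the
  common root add up to at most \<open>\<Sum>e\<^sub>j\<^sup>2\<bar>g(\<omega>)\<bar>\<^sup>2 \<le> \<bar>g(\<omega>)\<bar>\<^sup>2\<close>.
\<close>


section \<open>The space \<open>ell2 V\<close>: domination, inner product and Cauchy-Schwarz\<close>

lemma ell2D: "f \<in> ell2 V \<Longrightarrow> (\<lambda>v. (cmod (f v))\<^sup>2) summable_on V"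
  "f \<in> ell2 V \<Longrightarrow> v \<notin> V \<Longrightarrow> f v = 0"
  by (auto simp: ell2_def)

lemma ell2I: "(\<lambda>v. (cmod (f v))\<^sup>2) summable_on V \<Longrightarrow> (\<And>v. v \<notin> V \<Longrightarrow> f v = 0) \<Longrightarrow> f \<in> ell2 V"
  by (auto simp: ell2_def)

lemma ell2_norm_sq: "(ell2_norm V f)\<^sup>2 = (\<Sum>\<^sub>\<infinity>v\<in>V. (cmod (f v))\<^sup>2)"
  by (simp add: ell2_norm_def infsum_nonneg)

lemma ell2_norm_nonneg [simp]: "ell2_norm V f \<ge> 0"
  by (simp add: ell2_norm_def infsum_nonneg)

lemma ell2_norm_zero [simp]: "ell2_norm V (\<lambda>_. 0) = 0"
  by (simp add: ell2_norm_def)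

lemma ell2_zero [simp]: "(\<lambda>_. 0) \<in> ell2 V"
  by (simp add: ell2_def)

lemma ell2_dominated:
  assumes "f \<in> ell2 V" "\<And>v. v \<in> V \<Longrightarrow> cmod (g v) \<le> cmod (f v)" "\<And>v. v \<notin> V \<Longrightarrow> g v = 0"
  shows "g \<in> ell2 V" "ell2_norm V g \<le> ell2_norm V f"
proof -
  show *: "g \<in> ell2 V"
    using assms by (intro ell2I summable_on_comparison_test[OF ell2D(1)[OF assms(1)]])
      (auto intro: power_mono)
  show "ell2_norm V g \<le> ell2_norm V f"
    unfolding ell2_norm_def
    by (intro real_sqrt_le_mono infsum_mono ell2D * assms(1) power_mono assms(2)) auto
qed

lemma ell2_add:
  assumes "f \<in> ell2 V" "g \<in> ell2 V"
  shows "(\<lambda>v. f v + g v) \<in> ell2 V"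
proof (rule ell2I)
  have *: "(cmod (f v + g v))\<^sup>2 \<le> 2 * (cmod (f v))\<^sup>2 + 2 * (cmod (g v))\<^sup>2" for v
  proof -
    have "(cmod (f v + g v))\<^sup>2 \<le> (cmod (f v) + cmod (g v))\<^sup>2"
      by (intro power_mono norm_triangle_ineq) auto
    also have "\<dots> \<le> 2 * (cmod (f v))\<^sup>2 + 2 * (cmod (g v))\<^sup>2"
      using sum_squares_bound[of "cmod (f v)" "cmod (g v)"] by (simp add: power2_sum)
    finally show ?thesis .
  qed
  show "(\<lambda>v. (cmod (f v + g v))\<^sup>2) summable_on V"
    by (rule summable_on_comparison_test[where f = "\<lambda>v. 2 * (cmod (f v))\<^sup>2 + 2 * (cmod (g v))\<^sup>2"])
      (intro summable_on_add summable_on_cmult_right ell2D assms, use * in auto)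
qed (use assms in \<open>auto simp: ell2D\<close>)

lemma ell2_cmult:
  assumes "f \<in> ell2 V"
  shows "(\<lambda>v. c * f v) \<in> ell2 V" "ell2_norm V (\<lambda>v. c * f v) = cmod c * ell2_norm V f"
proof -
  show "(\<lambda>v. c * f v) \<in> ell2 V"
    using assms by (intro ell2I)
      (auto simp: ell2D norm_mult power_mult_distrib intro!: summable_on_cmult_right)
  show "ell2_norm V (\<lambda>v. c * f v) = cmod c * ell2_norm V f"
    by (simp add: ell2_norm_def norm_mult power_mult_distrib infsum_cmult_right' real_sqrt_mult)
qed

lemma ell2_diff:
  assumes "f \<in> ell2 V" "g \<in> ell2 V"
  shows "(\<lambda>v. f v - g v) \<in> ell2 V"
  using ell2_add[OF assms(1) ell2_cmult(1)[OF assms(2), of "-1"]] by simp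

lemma ell2_finite_support:
  assumes "finite F" "F \<subseteq> V"
  shows "(\<lambda>v. if v \<in> F then f v else 0) \<in> ell2 V"
    and "(ell2_norm V (\<lambda>v. if v \<in> F then f v else 0))\<^sup>2 = (\<Sum>v\<in>F. (cmod (f v))\<^sup>2)"
proof -
  have *: "((\<lambda>v. (cmod (if v \<in> F then f v else 0))\<^sup>2) has_sum (\<Sum>v\<in>F. (cmod (f v))\<^sup>2)) V"
    using assms by (intro has_sum_finite_neutralI) auto
  then show "(\<lambda>v. if v \<in> F then f v else 0) \<in> ell2 V"
    using assms by (intro ell2I) (auto dest: has_sum_imp_summable)
  show "(ell2_norm V (\<lambda>v. if v \<in> F then f v else 0))\<^sup>2 = (\<Sum>v\<in>F. (cmod (f v))\<^sup>2)"
    using * by (simp add: ell2_norm_sq infsumI)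
qed

lemma ell2_inner_abs_summable:
  assumes "f \<in> ell2 V" "g \<in> ell2 V"
  shows "(\<lambda>v. cmod (f v * cnj (g v))) summable_on V"
proof (rule Infinite_Sum.abs_summable_on_comparison_test')
  show "(\<lambda>v. (cmod (f v))\<^sup>2 + (cmod (g v))\<^sup>2) summable_on V"
    by (intro summable_on_add ell2D assms)
  show "norm (f v * cnj (g v)) \<le> (cmod (f v))\<^sup>2 + (cmod (g v))\<^sup>2" for v
    using sum_squares_bound[of "cmod (f v)" "cmod (g v)"]
      mult_nonneg_nonneg[OF norm_ge_zero norm_ge_zero, of "f v" "g v"]
    unfolding norm_mult complex_mod_cnj by linarith
qed

lemma ell2_inner_summable:
  assumes "f \<in> ell2 V" "g \<in> ell2 V"
  shows "(\<lambda>v. f v * cnj (g v)) summable_on V"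
  using ell2_inner_abs_summable[OF assms] by (rule abs_summable_summable)

text \<open>The finite inequality for \<open>L2_set\<close> bounds every finite partial sum of the
  absolute values by the product of the full norms, and the bound passes to the infinite
  sum.\<close>

lemma ell2_cauchy_schwarz:
  assumes "f \<in> ell2 V" "g \<in> ell2 V"
  shows "cmod (ell2_inner V f g) \<le> ell2_norm V f * ell2_norm V g"
proof -
  have L: "L2_set (\<lambda>v. cmod (h v)) F \<le> ell2_norm V h"
    if "finite F" "F \<subseteq> V" "h \<in> ell2 V" for h F
    unfolding L2_set_def ell2_norm_def using that
    by (intro real_sqrt_le_mono finite_sum_le_infsum ell2D) auto
  have "cmod (ell2_inner V f g) \<le> (\<Sum>\<^sub>\<infinity>v\<in>V. cmod (f v * cnj (g v)))"
    unfolding ell2_inner_def by (rule norm_infsum_bound[OF ell2_inner_abs_summable[OF assms]])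
  also have "\<dots> \<le> ell2_norm V f * ell2_norm V g"
  proof (rule infsum_le_finite_sums[OF ell2_inner_abs_summable[OF assms]])
    fix F assume F: "finite F" "F \<subseteq> V"
    have "(\<Sum>v\<in>F. cmod (f v * cnj (g v)))
        \<le> L2_set (\<lambda>v. cmod (f v)) F * L2_set (\<lambda>v. cmod (g v)) F"
      using L2_set_mult_ineq[of "\<lambda>v. cmod (f v)" "\<lambda>v. cmod (g v)" F] by (simp add: norm_mult)
    also have "\<dots> \<le> ell2_norm V f * ell2_norm V g"
      using F assms by (intro mult_mono L) auto
    finally show "(\<Sum>v\<in>F. cmod (f v * cnj (g v))) \<le> ell2_norm V f * ell2_norm V g" .
  qed
  finally show ?thesis .
qed

lemma ell2_inner_add_left:
  assumes "f \<in> ell2 V" "g \<in> ell2 V" "h \<in> ell2 V"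
  shows "ell2_inner V (\<lambda>v. f v + g v) h = ell2_inner V f h + ell2_inner V g h"
  unfolding ell2_inner_def using assms
  by (subst infsum_add[symmetric]) (auto simp: ell2_inner_summable algebra_simps)

lemma ell2_inner_cmult_left:
  "ell2_inner V (\<lambda>v. c * f v) h = c * ell2_inner V f h"
  by (simp add: ell2_inner_def mult.assoc infsum_cmult_right')

lemma ell2_inner_diff_left:
  assumes "f \<in> ell2 V" "g \<in> ell2 V" "h \<in> ell2 V"
  shows "ell2_inner V (\<lambda>v. f v - g v) h = ell2_inner V f h - ell2_inner V g h"
  using ell2_inner_add_left[OF assms(1) ell2_cmult(1)[OF assms(2), of "-1"] assms(3)]
    ell2_inner_cmult_left[of V "-1" g h] by simp

lemma ell2_inner_commute: "ell2_inner V g f = cnj (ell2_inner V f g)"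
  by (simp add: ell2_inner_def mult.commute flip: infsum_cnj)

lemma ell2_inner_diff_right:
  assumes "f \<in> ell2 V" "g \<in> ell2 V" "h \<in> ell2 V"
  shows "ell2_inner V h (\<lambda>v. f v - g v) = ell2_inner V h f - ell2_inner V h g"
  using arg_cong[OF ell2_inner_diff_left[OF assms], of cnj]
  by (simp flip: ell2_inner_commute)

lemma ell2_inner_self:
  assumes "f \<in> ell2 V"
  shows "ell2_inner V f f = of_real ((ell2_norm V f)\<^sup>2)"
  unfolding ell2_inner_def ell2_norm_sq
  by (rule infsumI) (use has_sum_of_real[OF has_sum_infsum[OF ell2D(1)[OF assms]]] in
      \<open>simp flip: complex_norm_square\<close>)

lemma ell2_norm_eq_0:
  assumes "f \<in> ell2 V" "ell2_norm V f = 0"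
  shows "f v = 0"
proof (cases "v \<in> V")
  case True
  have "(\<Sum>\<^sub>\<infinity>v\<in>V. (cmod (f v))\<^sup>2) \<le> 0"
    using assms(2) ell2_norm_sq[of V f] by simp
  then have "(cmod (f v))\<^sup>2 = 0"
    by (rule nonneg_infsum_le_0D[OF _ ell2D(1)[OF assms(1)]]) (use True in auto)
  then show ?thesis by simp
qed (use assms in \<open>simp add: ell2D\<close>)

text \<open>Cauchy-Schwarz followed by \<open>2ab <= a^2 + b^2\<close>. With an adjoint image as the
  second vector this becomes the inequality that tests hyponormality without adjoints.\<close>

lemma ell2_inner_le_squares:
  assumes "f \<in> ell2 V" "g \<in> ell2 V"
  shows "2 * Re (ell2_inner V f g) \<le> (ell2_norm V f)\<^sup>2 + (ell2_norm V g)\<^sup>2"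
  using ell2_cauchy_schwarz[OF assms] complex_Re_le_cmod[of "ell2_inner V f g"]
    sum_squares_bound[of "ell2_norm V f" "ell2_norm V g"] by simp

section \<open>Riesz representation by finite truncation\<close>

lemma ell2_norm_sq_tail:
  assumes "f \<in> ell2 V" "finite F" "F \<subseteq> V"
  shows "(ell2_norm V (\<lambda>v. f v - (if v \<in> F then f v else 0)))\<^sup>2
    = (ell2_norm V f)\<^sup>2 - (\<Sum>v\<in>F. (cmod (f v))\<^sup>2)"
proof -
  have F: "((\<lambda>v. (cmod (if v \<in> F then f v else 0))\<^sup>2) has_sum (\<Sum>v\<in>F. (cmod (f v))\<^sup>2)) V"
    using assms by (intro has_sum_finite_neutralI) auto
  have "((\<lambda>v. (cmod (f v))\<^sup>2 + - (cmod (if v \<in> F then f v else 0))\<^sup>2) has_sum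
      ((ell2_norm V f)\<^sup>2 + - (\<Sum>v\<in>F. (cmod (f v))\<^sup>2))) V"
    unfolding ell2_norm_sq
    by (intro has_sum_add has_sum_infsum ell2D assms has_sum_uminusI F)
  also have "(\<lambda>v. (cmod (f v))\<^sup>2 + - (cmod (if v \<in> F then f v else 0))\<^sup>2)
    = (\<lambda>v. (cmod (f v - (if v \<in> F then f v else 0)))\<^sup>2)"
    by auto
  finally show ?thesis by (simp add: ell2_norm_sq[of V "\<lambda>v. f v - _ v"] infsumI)
qed

text \<open>The representing vector must have the coordinates \<open>cnj (\<phi> (e u))\<close>.
  Boundedness of the functional puts it into \<open>ell2 V\<close>, and continuity extends the
  representation from finitely supported vectors to all of them.\<close>

lemma ell2_riesz:
  assumes add: "\<And>f g. f \<in> ell2 V \<Longrightarrow> g \<in> ell2 V \<Longrightarrow> \<phi> (\<lambda>v. f v + g v) = \<phi> f + \<phi> g"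
    and scale: "\<And>c f. f \<in> ell2 V \<Longrightarrow> \<phi> (\<lambda>v. c * f v) = c * \<phi> f"
    and bound: "\<And>f. f \<in> ell2 V \<Longrightarrow> cmod (\<phi> f) \<le> C * ell2_norm V f"
  obtains h where "h \<in> ell2 V" "\<And>f. f \<in> ell2 V \<Longrightarrow> \<phi> f = ell2_inner V f h"
proof -
  define e where "e u = (\<lambda>v. if v \<in> {u} then 1 else 0 :: complex)" for u :: 'a
  define h where "h u = (if u \<in> V then cnj (\<phi> (e u)) else 0)" for u
  have e: "e u \<in> ell2 V" if "u \<in> V" for u
    unfolding e_def using that by (intro ell2_finite_support) auto
  have \<phi>_finite: "\<phi> (\<lambda>v. if v \<in> F then f v else 0) = (\<Sum>u\<in>F. f u * cnj (h u))"
    if "finite F" "F \<subseteq> V" for F f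
    using that
  proof (induction F)
    case empty
    then show ?case using scale[OF ell2_zero, of 0] by simp
  next
    case (insert u F)
    have "(\<lambda>v. if v \<in> insert u F then f v else 0)
        = (\<lambda>v. f u * e u v + (if v \<in> F then f v else 0))"
      using insert by (auto simp: e_def)
    then have "\<phi> (\<lambda>v. if v \<in> insert u F then f v else 0)
        = f u * \<phi> (e u) + \<phi> (\<lambda>v. if v \<in> F then f v else 0)"
      using insert by (simp add: add scale ell2_cmult e ell2_finite_support)
    with insert show ?case by (simp add: h_def)
  qed
  have h: "h \<in> ell2 V"
  proof (rule ell2I)
    show "(\<lambda>v. (cmod (h v))\<^sup>2) summable_on V"
    proof (rule nonneg_bdd_above_summable_on)
      \<comment> \<open>Evaluating the functional at the truncation of \<open>h\<close> itself
        returns its squared norm, so the square of the norm is at most \<open>C\<close> times the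
        norm. Either the norm is zero or one factor cancels.\<close>
      have "(\<Sum>v\<in>F. (cmod (h v))\<^sup>2) \<le> C\<^sup>2" if F: "F \<subseteq> V" "finite F" for F
      proof -
        let ?s = "\<Sum>v\<in>F. (cmod (h v))\<^sup>2" and ?h = "\<lambda>v. if v \<in> F then h v else 0"
        have s: "(ell2_norm V ?h)\<^sup>2 = ?s" using ell2_finite_support(2) F by blast
        have "complex_of_real ?s = \<phi> ?h"
          using F by (simp add: \<phi>_finite flip: complex_norm_square)
        then have "?s = cmod (\<phi> ?h)"
          by (metis abs_of_nonneg norm_of_real s zero_le_power2)
        also have "\<dots> \<le> C * ell2_norm V ?h"
          using F by (intro bound ell2_finite_support)
        finally have "(ell2_norm V ?h)\<^sup>2 \<le> C * ell2_norm V ?h" using s by simp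
        then have "ell2_norm V ?h = 0 \<or> 0 < ell2_norm V ?h \<and> ell2_norm V ?h \<le> C"
          using ell2_norm_nonneg[of V ?h]
          by (metis less_eq_real_def mult_le_cancel_right_pos power2_eq_square)
        then show ?thesis
          unfolding s[symmetric] by (auto intro: power_mono)
      qed
      then show "bdd_above (sum (\<lambda>v. (cmod (h v))\<^sup>2) ` {F. F \<subseteq> V \<and> finite F})"
        by (auto intro!: bdd_aboveI)
    qed auto
  qed (simp add: h_def)
  have "\<phi> f = ell2_inner V f h" if f: "f \<in> ell2 V" for f
  proof -
    \<comment> \<open>The error of truncating \<open>f\<close> to \<open>F\<close> has norm
      \<open>sqrt\<close> of the full squared norm minus the partial sum. This tends to 0 along the
      finite subsets, and the functional follows by its bound.\<close>
    have "((\<lambda>F. \<Sum>u\<in>F. (cmod (f u))\<^sup>2) \<longlongrightarrow> (ell2_norm V f)\<^sup>2) (finite_subsets_at_top V)"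
      unfolding ell2_norm_sq using ell2D(1)[OF f] by (intro infsum_tendsto)
    then have "((\<lambda>F. C * sqrt ((ell2_norm V f)\<^sup>2 - (\<Sum>u\<in>F. (cmod (f u))\<^sup>2))) \<longlongrightarrow>
        C * sqrt ((ell2_norm V f)\<^sup>2 - (ell2_norm V f)\<^sup>2)) (finite_subsets_at_top V)"
      by (intro tendsto_intros)
    then have lim: "((\<lambda>F. C * sqrt ((ell2_norm V f)\<^sup>2 - (\<Sum>u\<in>F. (cmod (f u))\<^sup>2))) \<longlongrightarrow> 0)
        (finite_subsets_at_top V)"
      by simp
    have "cmod ((\<Sum>u\<in>F. f u * cnj (h u)) - \<phi> f)
        \<le> C * sqrt ((ell2_norm V f)\<^sup>2 - (\<Sum>u\<in>F. (cmod (f u))\<^sup>2))"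
      if F: "finite F" "F \<subseteq> V" for F
    proof -
      let ?f = "\<lambda>v. if v \<in> F then f v else 0"
      have fF: "?f \<in> ell2 V" using F by (rule ell2_finite_support)
      have "\<phi> f = \<phi> (\<lambda>v. f v - ?f v) + \<phi> ?f"
        using add[OF ell2_diff[OF f fF] fF] by simp
      then have "cmod ((\<Sum>u\<in>F. f u * cnj (h u)) - \<phi> f) = cmod (\<phi> (\<lambda>v. f v - ?f v))"
        using F by (simp add: \<phi>_finite)
      also have "\<dots> \<le> C * ell2_norm V (\<lambda>v. f v - ?f v)"
        by (rule bound[OF ell2_diff[OF f fF]])
      also have "ell2_norm V (\<lambda>v. f v - ?f v) = sqrt ((ell2_norm V f)\<^sup>2 - (\<Sum>u\<in>F. (cmod (f u))\<^sup>2))"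
        unfolding ell2_norm_sq_tail[OF f F, symmetric] by simp
      finally show ?thesis .
    qed
    then have "((\<lambda>F. (\<Sum>u\<in>F. f u * cnj (h u)) - \<phi> f) \<longlongrightarrow> 0) (finite_subsets_at_top V)"
      by (intro Lim_null_comparison[OF _ lim] eventually_finite_subsets_at_top_weakI)
    then have "((\<lambda>u. f u * cnj (h u)) has_sum \<phi> f) V"
      unfolding has_sum_def by (rule Lim_null[THEN iffD2])
    then show ?thesis by (simp add: ell2_inner_def infsumI)
  qed
  with h that show ?thesis by blast
qed

section \<open>Bounded operators, adjoints and hyponormality as an inequality\<close>

lemma bounded_operatorE:
  assumes "bounded_operator V T"
  obtains C where "C \<ge> 0" "\<And>f. f \<in> ell2 V \<Longrightarrow> ell2_norm V (T f) \<le> C * ell2_norm V f"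
proof -
  obtain C where C: "\<And>f. f \<in> ell2 V \<Longrightarrow> ell2_norm V (T f) \<le> C * ell2_norm V f"
    using assms unfolding bounded_operator_def by blast
  then have "ell2_norm V (T f) \<le> max C 0 * ell2_norm V f" if "f \<in> ell2 V" for f
    by (meson ell2_norm_nonneg max.cobounded1 mult_right_mono order_trans that)
  then show ?thesis using that[of "max C 0"] by simp
qed

lemma bounded_operator_ell2: "bounded_operator V T \<Longrightarrow> f \<in> ell2 V \<Longrightarrow> T f \<in> ell2 V"
  by (auto simp: bounded_operator_def)

lemma funpow_ell2: "bounded_operator V T \<Longrightarrow> f \<in> ell2 V \<Longrightarrow> (T ^^ n) f \<in> ell2 V"
  by (induction n) (auto intro: bounded_operator_ell2)

lemma bounded_operator_id: "bounded_operator V id"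
  unfolding bounded_operator_def by (auto intro!: exI[of _ 1])

lemma bounded_operator_comp:
  assumes "bounded_operator V S" "bounded_operator V T"
  shows "bounded_operator V (S \<circ> T)"
proof -
  obtain C where C: "C \<ge> 0" "\<And>f. f \<in> ell2 V \<Longrightarrow> ell2_norm V (S f) \<le> C * ell2_norm V f"
    using bounded_operatorE[OF assms(1)] by blast
  obtain D where D: "\<And>f. f \<in> ell2 V \<Longrightarrow> ell2_norm V (T f) \<le> D * ell2_norm V f"
    using bounded_operatorE[OF assms(2)] by blast
  have "ell2_norm V (S (T f)) \<le> (C * D) * ell2_norm V f" if "f \<in> ell2 V" for f
    using C(2)[OF bounded_operator_ell2[OF assms(2) that]] mult_left_mono[OF D[OF that] C(1)]
    by (simp add: mult.assoc)
  then show ?thesis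
    using assms unfolding bounded_operator_def by (auto simp: Pi_iff)
qed

lemma bounded_operator_funpow: "bounded_operator V T \<Longrightarrow> bounded_operator V (T ^^ n)"
  by (induction n) (auto simp: bounded_operator_id bounded_operator_comp)

text \<open>Riesz applied to the functional that pairs \<open>T f\<close> with \<open>g\<close>
  gives existence. Uniqueness is proved as well, since \<open>op_adjoint\<close> is a definite
  description.\<close>

lemma op_adjoint:
  assumes T: "bounded_operator V T" and g: "g \<in> ell2 V"
  shows "op_adjoint V T g \<in> ell2 V"
    and "f \<in> ell2 V \<Longrightarrow> ell2_inner V (T f) g = ell2_inner V f (op_adjoint V T g)"
proof -
  obtain C where C: "\<And>f. f \<in> ell2 V \<Longrightarrow> ell2_norm V (T f) \<le> C * ell2_norm V f"
    using bounded_operatorE[OF T] by blast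
  have Tl: "T f \<in> ell2 V" if "f \<in> ell2 V" for f
    by (rule bounded_operator_ell2[OF T that])
  obtain h where h: "h \<in> ell2 V" "\<And>f. f \<in> ell2 V \<Longrightarrow> ell2_inner V (T f) g = ell2_inner V f h"
  proof (rule ell2_riesz[of V "\<lambda>f. ell2_inner V (T f) g" "C * ell2_norm V g"])
    show "cmod (ell2_inner V (T f) g) \<le> C * ell2_norm V g * ell2_norm V f" if "f \<in> ell2 V" for f
      using ell2_cauchy_schwarz[OF Tl[OF that] g]
        mult_right_mono[OF C[OF that] ell2_norm_nonneg[of V g]] by (simp add: mult_ac)
  qed (use T g in \<open>auto simp: bounded_operator_def ell2_inner_add_left ell2_inner_cmult_left Pi_iff\<close>)
  \<comment> \<open>Two representing vectors have equal pairings with every vector, in particular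
    with their own difference, which therefore has norm zero.\<close>
  have "h' = h" if h': "h' \<in> ell2 V \<and> (\<forall>f\<in>ell2 V. ell2_inner V (T f) g = ell2_inner V f h')" for h'
  proof -
    let ?d = "\<lambda>v. h v - h' v"
    have d: "?d \<in> ell2 V" using h h' ell2_diff by blast
    have "ell2_inner V ?d ?d = ell2_inner V ?d h - ell2_inner V ?d h'"
      using h h' d by (intro ell2_inner_diff_right) auto
    also have "\<dots> = 0" using h h' d by (metis right_minus_eq)
    finally have "ell2_inner V ?d ?d = 0" .
    then show ?thesis
      using ell2_norm_eq_0[OF d] by (simp add: ell2_inner_self[OF d] fun_eq_iff)
  qed
  then have "op_adjoint V T g = h"
    unfolding op_adjoint_def using h by (intro the_equality) auto
  with h show "op_adjoint V T g \<in> ell2 V"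
    and "f \<in> ell2 V \<Longrightarrow> ell2_inner V (T f) g = ell2_inner V f (op_adjoint V T g)"
    by auto
qed

text \<open>Over all \<open>g\<close>, the maximum of \<open>2 Re \<langle>g, T\<^sup>*f\<rangle> - \<parallel>g\<parallel>\<^sup>2\<close> is \<open>\<parallel>T\<^sup>*f\<parallel>\<^sup>2\<close>, attained at \<open>g = T\<^sup>*f\<close>.\<close>

lemma hyponormal_iff:
  assumes T: "bounded_operator V T"
  shows "hyponormal V T \<longleftrightarrow> (\<forall>f\<in>ell2 V. \<forall>g\<in>ell2 V.
    2 * Re (ell2_inner V (T g) f) \<le> (ell2_norm V g)\<^sup>2 + (ell2_norm V (T f))\<^sup>2)"
proof -
  note l2 = bounded_operator_ell2[OF T] op_adjoint(1)[OF T]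
  have adj: "ell2_inner V (op_adjoint V T g) f = ell2_inner V g (T f)"
    if "f \<in> ell2 V" "g \<in> ell2 V" for f g
    using that by (subst (1 2) ell2_inner_commute) (simp add: op_adjoint(2)[OF T])
  have eq: "ell2_inner V (\<lambda>v. op_adjoint V T (T f) v - T (op_adjoint V T f) v) f
      = of_real ((ell2_norm V (T f))\<^sup>2 - (ell2_norm V (op_adjoint V T f))\<^sup>2)"
    if "f \<in> ell2 V" for f
    using that by (simp add: ell2_inner_diff_left l2 adj op_adjoint(2)[OF T] ell2_inner_self)
  have "hyponormal V T \<longleftrightarrow>
      (\<forall>f\<in>ell2 V. (ell2_norm V (op_adjoint V T f))\<^sup>2 \<le> (ell2_norm V (T f))\<^sup>2)"
    using T by (simp add: hyponormal_def positive_operator_def eq complex_nonneg_Reals_iff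
        del: of_real_diff)
  also have "\<dots> \<longleftrightarrow> (\<forall>f\<in>ell2 V. \<forall>g\<in>ell2 V.
    2 * Re (ell2_inner V (T g) f) \<le> (ell2_norm V g)\<^sup>2 + (ell2_norm V (T f))\<^sup>2)"
  proof (intro ball_cong refl iffI ballI)
    fix f g assume fg: "f \<in> ell2 V" "g \<in> ell2 V"
      and le: "(ell2_norm V (op_adjoint V T f))\<^sup>2 \<le> (ell2_norm V (T f))\<^sup>2"
    show "2 * Re (ell2_inner V (T g) f) \<le> (ell2_norm V g)\<^sup>2 + (ell2_norm V (T f))\<^sup>2"
      using ell2_inner_le_squares[OF fg(2) l2(2)[OF fg(1)]] le
      unfolding op_adjoint(2)[OF T fg] by linarith
  next
    fix f assume f: "f \<in> ell2 V" and le: "\<forall>g\<in>ell2 V.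
      2 * Re (ell2_inner V (T g) f) \<le> (ell2_norm V g)\<^sup>2 + (ell2_norm V (T f))\<^sup>2"
    show "(ell2_norm V (op_adjoint V T f))\<^sup>2 \<le> (ell2_norm V (T f))\<^sup>2"
      using bspec[OF le l2(2)[OF f]] f l2(2)[OF f]
      by (simp add: op_adjoint(2)[OF T] ell2_inner_self)
  qed
  finally show ?thesis .
qed

lemma power_hyponormal_iff:
  assumes T: "bounded_operator V T"
  shows "power_hyponormal V T \<longleftrightarrow> (\<forall>n\<ge>1. \<forall>f\<in>ell2 V. \<forall>g\<in>ell2 V.
    2 * Re (ell2_inner V ((T ^^ n) g) f) \<le> (ell2_norm V g)\<^sup>2 + (ell2_norm V ((T ^^ n) f))\<^sup>2)"
  using T hyponormal_iff[OF bounded_operator_funpow[OF T]] by (simp add: power_hyponormal_def)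

lemma op_norm_bound:
  assumes T: "bounded_operator V T" and f: "f \<in> ell2 V"
  shows "ell2_norm V (T f) \<le> op_norm V T * ell2_norm V f"
proof (cases "ell2_norm V f = 0")
  case True
  obtain C where "\<And>f. f \<in> ell2 V \<Longrightarrow> ell2_norm V (T f) \<le> C * ell2_norm V f"
    using bounded_operatorE[OF T] by blast
  from this[OF f] True show ?thesis by simp
next
  case False
  then have pos: "ell2_norm V f > 0" using ell2_norm_nonneg[of V f] by linarith
  obtain C where C: "C \<ge> 0" "\<And>f. f \<in> ell2 V \<Longrightarrow> ell2_norm V (T f) \<le> C * ell2_norm V f"
    using bounded_operatorE[OF T] by blast
  let ?c = "complex_of_real (1 / ell2_norm V f)"
  \<comment> \<open>A real supremum is known to be an upper bound only for sets bounded above; the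
    constant \<open>C\<close> provides this. The vector is then scaled to norm one.\<close>
  have "bdd_above ((\<lambda>f. ell2_norm V (T f)) ` {f \<in> ell2 V. ell2_norm V f \<le> 1})"
    using C by (intro bdd_aboveI2[where M = C]) (force intro: order_trans mult_left_le)
  moreover have "(\<lambda>v. ?c * f v) \<in> {f \<in> ell2 V. ell2_norm V f \<le> 1}"
    using f pos by (simp add: ell2_cmult norm_divide del: of_real_divide)
  ultimately have "ell2_norm V (T (\<lambda>v. ?c * f v)) \<le> op_norm V T"
    unfolding op_norm_def by (intro cSUP_upper)
  also have "T (\<lambda>v. ?c * f v) = (\<lambda>v. ?c * T f v)"
    using T f unfolding bounded_operator_def by blast
  also have "ell2_norm V \<dots> = ell2_norm V (T f) / ell2_norm V f"
    using pos f by (subst ell2_cmult(2)[OF bounded_operator_ell2[OF T]])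
      (simp_all add: norm_divide)
  finally show ?thesis using pos by (simp add: field_simps)
qed

lemma op_norm_le:
  assumes "C \<ge> 0" "\<And>f. f \<in> ell2 V \<Longrightarrow> ell2_norm V (T f) \<le> C * ell2_norm V f"
  shows "op_norm V T \<le> C"
  unfolding op_norm_def
proof (rule cSUP_least)
  show "{f \<in> ell2 V. ell2_norm V f \<le> 1} \<noteq> {}"
    using ell2_zero[of V] ell2_norm_zero[of V] by (auto intro!: exI[of _ "\<lambda>_. 0"])
  show "ell2_norm V (T f) \<le> C" if "f \<in> {f \<in> ell2 V. ell2_norm V f \<le> 1}" for f
    using that assms(2)[of f] mult_left_le[OF _ assms(1), of "ell2_norm V f"] by auto
qed

section \<open>Sums over smaller supports, option types and disjoint unions\<close>

lemma ell2_mono_neutral: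
  assumes "W \<subseteq> V" "\<And>x. x \<notin> W \<Longrightarrow> f x = 0"
  shows "f \<in> ell2 V \<longleftrightarrow> f \<in> ell2 W" "ell2_norm V f = ell2_norm W f"
proof -
  have "(\<lambda>x. (cmod (f x))\<^sup>2) summable_on V \<longleftrightarrow> (\<lambda>x. (cmod (f x))\<^sup>2) summable_on W"
    using assms by (intro summable_on_cong_neutral) auto
  then show "f \<in> ell2 V \<longleftrightarrow> f \<in> ell2 W"
    using assms by (auto simp: ell2_def)
  show "ell2_norm V f = ell2_norm W f"
    unfolding ell2_norm_def using assms by (intro arg_cong[where f = sqrt] infsum_cong_neutral) auto
qed

lemma has_sum_insert_None:
  fixes \<psi> :: "'a option \<Rightarrow> 'b :: {topological_comm_monoid_add, t2_space}"
  assumes "((\<lambda>v. \<psi> (Some v)) has_sum s) X"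
  shows "(\<psi> has_sum (\<psi> None + s)) (insert None (Some ` X))"
proof -
  have "(\<psi> has_sum s) (Some ` X)"
    using assms by (subst has_sum_reindex) (auto simp: o_def)
  then show ?thesis by (intro has_sum_insert) auto
qed

lemma summable_on_insert_None_iff:
  fixes \<psi> :: "'a option \<Rightarrow> real"
  shows "\<psi> summable_on insert None (Some ` X) \<longleftrightarrow> (\<lambda>v. \<psi> (Some v)) summable_on X"
  by (subst summable_on_insert_iff, subst summable_on_reindex) (auto simp: o_def)

lemma infsum_insert_None:
  fixes \<psi> :: "'a option \<Rightarrow> 'b :: {topological_comm_monoid_add, t2_space}"
  assumes "(\<lambda>v. \<psi> (Some v)) summable_on X"
  shows "infsum \<psi> (insert None (Some ` X)) = \<psi> None + (\<Sum>\<^sub>\<infinity>v\<in>X. \<psi> (Some v))"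
  using assms by (intro infsumI has_sum_insert_None has_sum_infsum)

text \<open>Disjointness makes the union a bijective image of the dependent sum
  \<open>Sigma J V\<close>, where summation can be done fibrewise. Estimates on single trees are
  added up through this lemma.\<close>

lemma has_sum_infsum_UN:
  fixes F :: "'a \<Rightarrow> real"
  assumes "F summable_on (\<Union>j\<in>J. V j)" "disjoint_family_on V J"
  shows "((\<lambda>j. infsum F (V j)) has_sum infsum F (\<Union>j\<in>J. V j)) J"
proof (rule has_sum_Sigma'[where f = "F \<circ> snd"])
  have U: "(\<Union>j\<in>J. V j) = snd ` Sigma J V" by force
  have inj: "inj_on snd (Sigma J V)"
    using assms(2) by (intro inj_onI) (force simp: disjoint_family_on_def)
  show "((F \<circ> snd) has_sum infsum F (\<Union>j\<in>J. V j)) (Sigma J V)"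
    using has_sum_infsum[OF assms(1)] unfolding U by (simp add: has_sum_reindex[OF inj])
  show "((\<lambda>v. (F \<circ> snd) (j, v)) has_sum infsum F (V j)) (V j)" if "j \<in> J" for j
    using summable_on_subset[OF assms(1) UN_upper[OF that]] by simp
qed

section \<open>Roots, and general facts on weighted shifts\<close>

lemma is_root_iff:
  assumes "rooted_directed_tree V p"
  shows "is_root V p v \<longleftrightarrow> v = tree_root V p"
proof -
  \<comment> \<open>All iterates of \<open>p\<close> fix a root. Two roots lie in the only
    equivalence class, so some iterates of them coincide, which are the roots themselves.\<close>
  have root_unique: "v = w" if v: "is_root V p v" and w: "is_root V p w" for v w
  proof -
    have fixed: "(p ^^ n) x = x" if "is_root V p x" for x n
      using that by (induction n) (auto simp: is_root_def)
    have "same_tree V p `` {v} \<in> V // same_tree V p" "same_tree V p `` {w} \<in> V // same_tree V p"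
      using v w by (auto simp: is_root_def intro: quotientI)
    then have "same_tree V p `` {v} = same_tree V p `` {w}"
      using assms unfolding rooted_directed_tree_def directed_tree_def by blast
    moreover have "w \<in> same_tree V p `` {w}"
      using w by (auto simp: same_tree_def is_root_def)
    ultimately have "(v, w) \<in> same_tree V p" by blast
    then show ?thesis
      using fixed[OF v] fixed[OF w] by (force simp: same_tree_def)
  qed
  obtain w where w: "is_root V p w"
    using assms unfolding rooted_directed_tree_def by blast
  then have "tree_root V p = w"
    unfolding tree_root_def using root_unique by blast
  with w root_unique show ?thesis by blast
qed

lemma bounded_operator_weighted_shiftI:
  assumes "\<And>f. f \<in> ell2 V \<Longrightarrow> weighted_shift V p lam f \<in> ell2 V"
    and "\<And>f. f \<in> ell2 V \<Longrightarrow> ell2_norm V (weighted_shift V p lam f) \<le> C * ell2_norm V f"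
  shows "bounded_operator V (weighted_shift V p lam)"
  unfolding bounded_operator_def using assms
  by (auto simp: weighted_shift_def fun_eq_iff algebra_simps intro: exI[of _ C])

text \<open>A shift computes each value from a single value of its argument, the one at the parent.
  Erasing some values of \<open>f\<close> thus erases values of the image or leaves them untouched,
  and nothing else can change.\<close>

lemma weighted_shift_funpow_restrict:
  assumes "\<forall>x. f' x = 0 \<or> f' x = f x"
  shows "\<forall>x. (weighted_shift V p lam ^^ n) f' x = 0 \<or>
    (weighted_shift V p lam ^^ n) f' x = (weighted_shift V p lam ^^ n) f x"
proof (induction n)
  case (Suc n)
  show ?case
  proof
    fix x
    show "(weighted_shift V p lam ^^ Suc n) f' x = 0 \<or>
        (weighted_shift V p lam ^^ Suc n) f' x = (weighted_shift V p lam ^^ Suc n) f x"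
      using spec[OF Suc, of "p x"]
      by (auto simp: weighted_shift_def[of V p lam "(weighted_shift V p lam ^^ n) _"])
  qed
qed (use assms in simp)

section \<open>The rooted sum, its trees and their one-step extensions\<close>

locale rooted_sum_shift =
  fixes J :: "'j set" and V :: "'j \<Rightarrow> 'a set" and p :: "'j \<Rightarrow> 'a \<Rightarrow> 'a"
    and lam :: "'a \<Rightarrow> complex" and lam' :: "'a option \<Rightarrow> complex"
  assumes tree: "j \<in> J \<Longrightarrow> rooted_directed_tree (V j) (p j)"
    and disjoint: "disjoint_family_on V J"
    and weight_None: "lam' None = 0"
    and weight_Some: "j \<in> J \<Longrightarrow> v \<in> V j \<Longrightarrow> v \<noteq> tree_root (V j) (p j) \<Longrightarrow> lam' (Some v) = lam v"
begin

abbreviation "\<omega> j \<equiv> tree_root (V j) (p j)"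
abbreviation "W \<equiv> rooted_sum_vertices J V"
abbreviation "W1 j \<equiv> backward_ext_vertices (V j)"
text \<open>The locale leaves \<open>lam'\<close> free at the roots \<open>\<omega> j\<close>, so
  that it serves both implications. The extension \<open>E\<close> takes its root weight
  \<open>c\<close> as a separate argument, because the weight that makes it power hyponormal may
  differ from the weight in the sum.\<close>

definition "R = weighted_shift W (rooted_sum_parent J V p) lam'"
definition "S j = weighted_shift (V j) (p j) (lam(\<omega> j := 0))"
definition "E j c = weighted_shift (W1 j) (backward_ext_parent (V j) (p j))
  (backward_ext_weights (V j) (p j) (lam(\<omega> j := 0)) c)"

lemma W_def: "W = insert None (Some ` (\<Union>j\<in>J. V j))"
  by (simp add: rooted_sum_vertices_def)

lemma W1_def: "W1 j = insert None (Some ` V j)"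
  by (simp add: backward_ext_vertices_def)

lemma W1_subset: "j \<in> J \<Longrightarrow> W1 j \<subseteq> W"
  by (auto simp: W_def W1_def)

lemma root_in: "j \<in> J \<Longrightarrow> \<omega> j \<in> V j"
  using is_root_iff[OF tree, of j "\<omega> j"] by (simp add: is_root_def)

lemma parent_in: "j \<in> J \<Longrightarrow> v \<in> V j \<Longrightarrow> p j v \<in> V j"
  using tree[of j] by (auto simp: rooted_directed_tree_def directed_tree_def directed_forest_def)

lemma parent_eq_iff: "j \<in> J \<Longrightarrow> v \<in> V j \<Longrightarrow> p j v = v \<longleftrightarrow> v = \<omega> j"
  using is_root_iff[OF tree, of j v] by (simp add: is_root_def)

lemma index_eq: "j \<in> J \<Longrightarrow> k \<in> J \<Longrightarrow> v \<in> V j \<Longrightarrow> v \<in> V k \<Longrightarrow> j = k"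
  using disjoint by (auto simp: disjoint_family_on_def)

lemma rooted_sum_parent_Some:
  assumes "j \<in> J" "v \<in> V j"
  shows "rooted_sum_parent J V p (Some v) = (if v = \<omega> j then None else Some (p j v))"
proof -
  have "(THE j. j \<in> J \<and> v \<in> V j) = j"
    using assms index_eq by (intro the_equality) auto
  then show ?thesis by (simp add: rooted_sum_parent_def Let_def)
qed

lemma is_root_W_iff: "is_root W (rooted_sum_parent J V p) x \<longleftrightarrow> x = None"
proof (cases x)
  case None
  then show ?thesis by (simp add: is_root_def W_def rooted_sum_parent_def)
next
  case (Some v)
  then show ?thesis
    by (auto simp: is_root_def W_def rooted_sum_parent_Some parent_eq_iff split: if_splits)
qed

lemma is_root_W1_iff:
  assumes "j \<in> J"
  shows "is_root (W1 j) (backward_ext_parent (V j) (p j)) x \<longleftrightarrow> x = None"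
  using assms
  by (cases x) (auto simp: is_root_def W1_def backward_ext_parent_def parent_eq_iff)

lemma R_None [simp]: "R f None = 0"
  by (simp add: R_def weighted_shift_def weight_None)

lemma R_Some:
  assumes "j \<in> J" "v \<in> V j"
  shows "R f (Some v) = (if v = \<omega> j then lam' (Some v) * f None else lam v * f (Some (p j v)))"
  using assms by (auto simp: R_def weighted_shift_def W_def rooted_sum_parent_Some weight_Some)

lemma E_None [simp]: "E j c f None = 0"
  by (simp add: E_def weighted_shift_def backward_ext_weights_def)

lemma E_Some:
  assumes "v \<in> V j"
  shows "E j c f (Some v) = (if v = \<omega> j then c * f None else lam v * f (Some (p j v)))"
  using assms
  by (auto simp: E_def weighted_shift_def W1_def backward_ext_parent_def backward_ext_weights_def)

lemma S_apply:
  "S j h v = (if v \<in> V j \<and> v \<noteq> \<omega> j then lam v * h (p j v) else 0)"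
  by (simp add: S_def weighted_shift_def)

text \<open>At \<open>\<omega> j\<close> the two shifts produce \<open>c * (e * f None)\<close> and
  \<open>(e * c) * f None\<close>, which agree; elsewhere on \<open>V j\<close> the weights are the
  same. After one step both values at \<open>None\<close> are 0, so the scaling relation there
  persists.\<close>

lemma funpow_E_R:
  assumes j: "j \<in> J" and "lam' (Some (\<omega> j)) = e * c"
    and "f' None = e * f None" "\<And>v. v \<in> V j \<Longrightarrow> f' (Some v) = f (Some v)"
  shows "(E j c ^^ n) f' None = e * (R ^^ n) f None \<and>
    (\<forall>v\<in>V j. (E j c ^^ n) f' (Some v) = (R ^^ n) f (Some v))"
proof (induction n)
  case (Suc n)
  then show ?case
    using j assms(2) by (simp add: R_Some E_Some parent_in)
qed (use assms in simp)

text \<open>Nothing leaks out of \<open>V j\<close>: a vertex of another tree has its parent in that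
  tree or at \<open>None\<close>, and the argument vanishes at both. For the same reason
  \<open>\<omega> j\<close> receives 0, as it does under \<open>S j\<close>.\<close>

lemma R_case_option:
  assumes "j \<in> J" "\<And>v. v \<notin> V j \<Longrightarrow> h v = 0"
  shows "R (case_option 0 h) = case_option 0 (S j h)"
proof
  fix x
  show "R (case_option 0 h) x = case_option 0 (S j h) x"
  proof (cases x)
    case (Some v)
    show ?thesis
    proof (cases "\<exists>k\<in>J. v \<in> V k")
      case True
      then obtain k where k: "k \<in> J" "v \<in> V k" by blast
      show ?thesis
      proof (cases "k = j")
        case False
        then have "h (p k v) = 0" "v \<notin> V j"
          using assms k index_eq parent_in by blast+
        then show ?thesis using Some k by (simp add: R_Some S_apply)
      qed (use Some k in \<open>simp add: R_Some S_apply\<close>)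
    next
      case False
      then show ?thesis
        using Some assms(1) by (auto simp: R_def weighted_shift_def W_def S_apply)
    qed
  qed simp
qed

lemma funpow_R_case_option:
  assumes j: "j \<in> J" and h: "\<And>v. v \<notin> V j \<Longrightarrow> h v = 0"
  shows "(R ^^ n) (case_option 0 h) = case_option 0 ((S j ^^ n) h)"
proof (induction n)
  case (Suc n)
  have "(S j ^^ n) h v = 0" if "v \<notin> V j" for v
    using that h by (cases n) (auto simp: S_apply)
  then have "R (case_option 0 ((S j ^^ n) h)) = case_option 0 (S j ((S j ^^ n) h))"
    by (rule R_case_option[OF j])
  with Suc show ?case unfolding funpow.simps o_apply by argo
qed (simp only: funpow.simps id_apply)

section \<open>Norms and inner products on the sum and on the extensions\<close>

lemma ell2_W_iff:
  "f \<in> ell2 W \<longleftrightarrow> (\<forall>x. x \<notin> W \<longrightarrow> f x = 0) \<and>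
    (\<lambda>v. (cmod (f (Some v)))\<^sup>2) summable_on (\<Union>j\<in>J. V j)"
  by (simp add: ell2_def W_def summable_on_insert_None_iff)

lemma ell2_norm_W:
  assumes "f \<in> ell2 W"
  shows "(ell2_norm W f)\<^sup>2 = (cmod (f None))\<^sup>2 + (\<Sum>\<^sub>\<infinity>v\<in>(\<Union>j\<in>J. V j). (cmod (f (Some v)))\<^sup>2)"
  using ell2D(1)[OF assms] unfolding ell2_norm_sq W_def summable_on_insert_None_iff
  by (rule infsum_insert_None)

lemma ell2_W1_iff:
  "f \<in> ell2 (W1 j) \<longleftrightarrow> (\<forall>x. x \<notin> W1 j \<longrightarrow> f x = 0) \<and> (\<lambda>v. (cmod (f (Some v)))\<^sup>2) summable_on V j"
  by (simp add: ell2_def W1_def summable_on_insert_None_iff)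

lemma ell2_norm_W1:
  assumes "f \<in> ell2 (W1 j)"
  shows "(ell2_norm (W1 j) f)\<^sup>2 = (cmod (f None))\<^sup>2 + (\<Sum>\<^sub>\<infinity>v\<in>V j. (cmod (f (Some v)))\<^sup>2)"
  using ell2D(1)[OF assms] unfolding ell2_norm_sq W1_def summable_on_insert_None_iff
  by (rule infsum_insert_None)

lemma ell2_inner_W1:
  assumes "f \<in> ell2 (W1 j)" "g \<in> ell2 (W1 j)"
  shows "ell2_inner (W1 j) f g =
    f None * cnj (g None) + (\<Sum>\<^sub>\<infinity>v\<in>V j. f (Some v) * cnj (g (Some v)))"
proof -
  have "(\<lambda>v. f (Some v) * cnj (g (Some v))) summable_on V j"
    using summable_on_subset[OF ell2_inner_summable[OF assms], of "Some ` V j"]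
    by (auto simp: summable_on_reindex o_def W1_def)
  then show ?thesis unfolding ell2_inner_def W1_def by (rule infsum_insert_None)
qed

lemma ell2_W1_subset:
  assumes "j \<in> J" "\<And>x. x \<notin> W1 j \<Longrightarrow> f x = 0"
  shows "f \<in> ell2 W \<longleftrightarrow> f \<in> ell2 (W1 j)" "ell2_norm W f = ell2_norm (W1 j) f"
  using ell2_mono_neutral[OF W1_subset[OF assms(1)]] assms(2) by auto

text \<open>Extension by zero is an isometric embedding. Together with \<open>R_case_option\<close>
  it carries norm bounds and inequalities from \<open>R\<close> down to \<open>S j\<close>.\<close>

lemma ell2_case_option:
  assumes "j \<in> J" "h \<in> ell2 (V j)"
  shows "case_option 0 h \<in> ell2 W" "ell2_norm W (case_option 0 h) = ell2_norm (V j) h"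
proof -
  have *: "case_option 0 h x = 0" if "x \<notin> W1 j" for x
    using that ell2D(2)[OF assms(2)] by (auto simp: W1_def split: option.splits)
  have h: "case_option 0 h \<in> ell2 (W1 j)"
    using * ell2D(1)[OF assms(2)] by (simp add: ell2_W1_iff)
  then show "case_option 0 h \<in> ell2 W"
    using ell2_W1_subset(1)[OF assms(1), of "case_option 0 h"] * by blast
  have "(ell2_norm W (case_option 0 h))\<^sup>2 = (ell2_norm (V j) h)\<^sup>2"
    using ell2_norm_W1[OF h] ell2_W1_subset(2)[OF assms(1), of "case_option 0 h"] * by (simp add: ell2_norm_sq[of "V j"])
  then show "ell2_norm W (case_option 0 h) = ell2_norm (V j) h"
    by simp
qed

lemma ell2_inner_case_option:
  assumes "j \<in> J" "h \<in> ell2 (V j)"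
  shows "ell2_inner W f (case_option 0 h) = ell2_inner (V j) (\<lambda>v. f (Some v)) h"
proof -
  have "ell2_inner W f (case_option 0 h)
      = (\<Sum>\<^sub>\<infinity>x\<in>Some ` V j. f x * cnj (case_option 0 h x))"
    unfolding ell2_inner_def using assms(1) ell2D(2)[OF assms(2)]
    by (intro infsum_cong_neutral) (auto simp: W_def inj_image_mem_iff)
  also have "\<dots> = ell2_inner (V j) (\<lambda>v. f (Some v)) h"
    unfolding ell2_inner_def by (subst infsum_reindex) (auto simp: o_def)
  finally show ?thesis .
qed

section \<open>From the rooted sum to the trees and their extensions\<close>

lemma op_norm_S_le:
  assumes j: "j \<in> J" and C: "C \<ge> 0" "\<And>f. f \<in> ell2 W \<Longrightarrow> ell2_norm W (R f) \<le> C * ell2_norm W f"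
    and S: "bounded_operator (V j) (S j)"
  shows "op_norm (V j) (S j) \<le> C"
proof (rule op_norm_le[OF C(1)])
  fix h assume h: "h \<in> ell2 (V j)"
  have "R (case_option 0 h) = case_option 0 (S j h)"
    using j h by (intro R_case_option) (auto simp: ell2D)
  then show "ell2_norm (V j) (S j h) \<le> C * ell2_norm (V j) h"
    using C(2)[OF ell2_case_option(1)[OF j h]] ell2_case_option(2)[OF j h]
      ell2_case_option(2)[OF j bounded_operator_ell2[OF S h]] by simp
qed

lemma power_hyponormal_S:
  assumes j: "j \<in> J" and S: "bounded_operator (V j) (S j)"
    and R: "bounded_operator W R" "power_hyponormal W R"
  shows "power_hyponormal (V j) (S j)"
  unfolding power_hyponormal_iff[OF S]
proof (intro allI impI ballI)
  fix n :: nat and f g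
  assume n: "n \<ge> 1" and fg: "f \<in> ell2 (V j)" "g \<in> ell2 (V j)"
  note l2 = ell2_case_option[OF j]
  have eq: "(R ^^ n) (case_option 0 h) = case_option 0 ((S j ^^ n) h)" if "h \<in> ell2 (V j)" for h
    using j that by (intro funpow_R_case_option) (auto simp: ell2D)
  show "2 * Re (ell2_inner (V j) ((S j ^^ n) g) f)
      \<le> (ell2_norm (V j) g)\<^sup>2 + (ell2_norm (V j) ((S j ^^ n) f))\<^sup>2"
    using R(2)[unfolded power_hyponormal_iff[OF R(1)], rule_format, OF n l2(1) l2(1), OF fg]
      ell2_inner_case_option[OF j fg(1), of "case_option 0 ((S j ^^ n) g)"]
    by (simp add: eq fg l2(2) funpow_ell2[OF S])
qed

lemma ell2_pointwise_le:
  assumes "j \<in> J" "f \<in> ell2 W" "\<And>x. x \<notin> W1 j \<Longrightarrow> f' x = 0" "\<And>x. f' x = 0 \<or> f' x = f x"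
  shows "f' \<in> ell2 (W1 j)" "ell2_norm (W1 j) f' \<le> ell2_norm W f"
proof -
  have *: "x \<notin> W \<Longrightarrow> f' x = 0" "cmod (f' x) \<le> cmod (f x)" for x
    using assms(3)[of x] assms(4)[of x] W1_subset[OF assms(1)] by auto
  show "f' \<in> ell2 (W1 j)" "ell2_norm (W1 j) f' \<le> ell2_norm W f"
    using ell2_dominated[OF assms(2) *(2) *(1)] ell2_W1_subset[OF assms(1,3)] by auto
qed

lemma bounded_operator_E:
  assumes j: "j \<in> J" and R: "bounded_operator W R"
  shows "bounded_operator (W1 j) (E j (lam' (Some (\<omega> j))))"
proof -
  let ?c = "lam' (Some (\<omega> j))"
  obtain C where C: "\<And>f. f \<in> ell2 W \<Longrightarrow> ell2_norm W (R f) \<le> C * ell2_norm W f"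
    using bounded_operatorE[OF R] by blast
  have *: "E j ?c f \<in> ell2 (W1 j) \<and> ell2_norm (W1 j) (E j ?c f) \<le> C * ell2_norm (W1 j) f"
    if f: "f \<in> ell2 (W1 j)" for f
  proof -
    have fW: "f \<in> ell2 W" "ell2_norm W f = ell2_norm (W1 j) f"
      using ell2_W1_subset[OF j, of f] f ell2D(2)[OF f] by simp_all
    have out: "E j ?c f x = 0" if "x \<notin> W1 j" for x
      using that by (simp add: E_def weighted_shift_def)
    \<comment> \<open>For the weight taken from the sum, \<open>E\<close> acts as \<open>R\<close>
      followed by truncation to \<open>W1 j\<close>, so the bound for \<open>R\<close> holds with
      the same constant.\<close>
    have or: "E j ?c f x = 0 \<or> E j ?c f x = R f x" for x
    proof (cases "x \<in> W1 j")
      case True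
      then show ?thesis using j by (auto simp: W1_def E_Some R_Some)
    qed (use out in simp)
    show ?thesis
      using ell2_pointwise_le[OF j bounded_operator_ell2[OF R fW(1)] out or] C[OF fW(1)]
      unfolding fW(2) by simp
  qed
  show ?thesis
    unfolding E_def by (rule bounded_operator_weighted_shiftI) (use * in \<open>auto simp: E_def\<close>)
qed

text \<open>The inequality for \<open>R\<close> is applied to \<open>g\<close> and to
  \<open>f\<close> with its value at \<open>None\<close> removed. That value would be spread by
  \<open>R\<close> into the other trees and enlarge the norm on the sum. Its removal keeps the inner
  product, since an image under a positive power vanishes at \<open>None\<close>, and it can only
  decrease the norm of the image on \<open>V j\<close>.\<close>

lemma power_hyponormal_E:
  assumes j: "j \<in> J" and S: "bounded_operator (V j) (S j)"
    and R: "bounded_operator W R" "power_hyponormal W R"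
  shows "power_hyponormal (W1 j) (E j (lam' (Some (\<omega> j))))"
  unfolding power_hyponormal_iff[OF bounded_operator_E[OF j R(1)]]
proof (intro allI impI ballI)
  let ?E = "E j (lam' (Some (\<omega> j)))"
  fix n :: nat and f g
  assume n: "n \<ge> 1" and fg: "f \<in> ell2 (W1 j)" "g \<in> ell2 (W1 j)"
  define h where "h v = f (Some v)" for v
  have h: "h \<in> ell2 (V j)"
    using fg(1) unfolding ell2_W1_iff by (intro ell2I) (auto simp: h_def W1_def)
  have gW: "g \<in> ell2 W" "ell2_norm W g = ell2_norm (W1 j) g"
    using ell2_W1_subset[OF j, of g] fg(2) ell2D(2)[OF fg(2)] by simp_all
  note Enl2 = funpow_ell2[OF bounded_operator_E[OF j R(1)]]
  \<comment> \<open>Both root weights coincide, so \<open>funpow_E_R\<close> applies with ratio 1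
    and no rescaling.\<close>
  have E_R: "(?E ^^ n) g' (Some v) = (R ^^ n) g' (Some v)" if "v \<in> V j" for v g'
    using funpow_E_R[OF j, of 1 _ g' g' n] that by simp
  have E_None: "(?E ^^ n) g' None = 0" for g'
    using n by (cases n) auto
  have "ell2_inner W ((R ^^ n) g) (case_option 0 h)
      = (\<Sum>\<^sub>\<infinity>v\<in>V j. (R ^^ n) g (Some v) * cnj (f (Some v)))"
    by (simp add: ell2_inner_case_option[OF j h]) (simp add: ell2_inner_def h_def)
  also have "\<dots> = ell2_inner (W1 j) ((?E ^^ n) g) f"
    by (simp add: ell2_inner_W1[OF Enl2[OF fg(2)] fg(1)] E_None E_R cong: infsum_cong)
  finally have inner: "ell2_inner W ((R ^^ n) g) (case_option 0 h) = ell2_inner (W1 j) ((?E ^^ n) g) f" .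
  have Rn: "(R ^^ n) (case_option 0 h) = case_option 0 ((S j ^^ n) h)"
    using j h by (intro funpow_R_case_option) (auto simp: ell2D)
  have *: "case_option 0 h x = 0 \<or> case_option 0 h x = f x" for x
    by (simp add: h_def split: option.split)
  have restrict: "(R ^^ n) (case_option 0 h) x = 0 \<or> (R ^^ n) (case_option 0 h) x = (R ^^ n) f x" for x
    unfolding R_def using weighted_shift_funpow_restrict[where f' = "case_option 0 h" and f = f] *
    by blast
  have "(ell2_norm W ((R ^^ n) (case_option 0 h)))\<^sup>2
      = (\<Sum>\<^sub>\<infinity>v\<in>V j. (cmod ((R ^^ n) (case_option 0 h) (Some v)))\<^sup>2)"
    unfolding Rn ell2_case_option(2)[OF j funpow_ell2[OF S h]] by (simp add: ell2_norm_sq)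
  also have "\<dots> \<le> (\<Sum>\<^sub>\<infinity>v\<in>V j. (cmod ((?E ^^ n) f (Some v)))\<^sup>2)"
  proof (rule infsum_mono)
    show "(\<lambda>v. (cmod ((R ^^ n) (case_option 0 h) (Some v)))\<^sup>2) summable_on V j"
      using ell2D(1)[OF funpow_ell2[OF S h]] by (simp add: Rn)
    show "(\<lambda>v. (cmod ((?E ^^ n) f (Some v)))\<^sup>2) summable_on V j"
      using Enl2[OF fg(1)] by (simp add: ell2_W1_iff)
    show "(cmod ((R ^^ n) (case_option 0 h) (Some v)))\<^sup>2 \<le> (cmod ((?E ^^ n) f (Some v)))\<^sup>2"
      if "v \<in> V j" for v
      using restrict[of "Some v"] E_R[OF that, of f] by auto
  qed
  also have "\<dots> = (ell2_norm (W1 j) ((?E ^^ n) f))\<^sup>2"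
    by (simp add: ell2_norm_W1[OF Enl2[OF fg(1)]] E_None)
  finally have norm: "(ell2_norm W ((R ^^ n) (case_option 0 h)))\<^sup>2
      \<le> (ell2_norm (W1 j) ((?E ^^ n) f))\<^sup>2" .
  show "2 * Re (ell2_inner (W1 j) ((?E ^^ n) g) f)
      \<le> (ell2_norm (W1 j) g)\<^sup>2 + (ell2_norm (W1 j) ((?E ^^ n) f))\<^sup>2"
    using R(2)[unfolded power_hyponormal_iff[OF R(1)], rule_format, OF n ell2_case_option(1)[OF j h] gW(1)]
      norm unfolding inner gW(2) by linarith
qed

section \<open>From the extensions to the rooted sum\<close>

lemma bounded_operator_R:
  assumes S: "\<And>j. j \<in> J \<Longrightarrow> bounded_operator (V j) (S j)"
    and M: "\<And>j. j \<in> J \<Longrightarrow> op_norm (V j) (S j) \<le> M"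
    and D: "(\<lambda>j. (cmod (lam' (Some (\<omega> j))))\<^sup>2) summable_on J"
  shows "bounded_operator W R"
proof -
  define d where "d j = (cmod (lam' (Some (\<omega> j))))\<^sup>2" for j
  have d: "d summable_on J" using D unfolding d_def .
  \<comment> \<open>On \<open>V j\<close> the image \<open>R f\<close> is \<open>S j\<close> of the
    restriction of \<open>f\<close>, plus the value that \<open>\<omega> j\<close> receives from
    \<open>None\<close>. The first parts contribute at most the factor \<open>M^2\<close>, the
    second ones the sum of the squared root weights.\<close>
  have *: "R f \<in> ell2 W \<and> ell2_norm W (R f) \<le> sqrt (M\<^sup>2 + infsum d J) * ell2_norm W f"
    if f: "f \<in> ell2 W" for f
  proof -
    let ?U = "\<Union>j\<in>J. V j"
    let ?F = "\<lambda>v. (cmod (f (Some v)))\<^sup>2" and ?G = "\<lambda>v. (cmod (R f (Some v)))\<^sup>2"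
    define h where "h j v = (if v \<in> V j then f (Some v) else 0)" for j v
    define b where "b j = M\<^sup>2 * infsum ?F (V j) + d j * (cmod (f None))\<^sup>2" for j
    have F: "?F summable_on ?U" using f by (simp add: ell2_W_iff)
    have FV: "?F summable_on V j" if "j \<in> J" for j
      using summable_on_subset[OF F UN_upper[OF that]] .
    have h: "h j \<in> ell2 (V j)" "(ell2_norm (V j) (h j))\<^sup>2 = infsum ?F (V j)" if "j \<in> J" for j
      using FV[OF that] by (auto simp: h_def ell2_norm_sq intro!: ell2I infsum_cong cong: summable_on_cong)
    have G: "(?G has_sum ((ell2_norm (V j) (S j (h j)))\<^sup>2 + d j * (cmod (f None))\<^sup>2)) (V j)"
      if j: "j \<in> J" for j
    proof -
      \<comment> \<open>The squares add without a cross term, because \<open>S j (h j)\<close>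
        vanishes at \<open>\<omega> j\<close>, the only place where the other summand may be
        nonzero.\<close>
      have "((\<lambda>v. (cmod (S j (h j) v))\<^sup>2 + (if v = \<omega> j then d j * (cmod (f None))\<^sup>2 else 0)) has_sum
          ((ell2_norm (V j) (S j (h j)))\<^sup>2 + d j * (cmod (f None))\<^sup>2)) (V j)"
        unfolding ell2_norm_sq
      proof (rule has_sum_add)
        show "((\<lambda>v. (cmod (S j (h j) v))\<^sup>2) has_sum (\<Sum>\<^sub>\<infinity>v\<in>V j. (cmod (S j (h j) v))\<^sup>2)) (V j)"
          by (intro has_sum_infsum ell2D bounded_operator_ell2[OF S[OF j] h(1)[OF j]])
        show "((\<lambda>v. if v = \<omega> j then d j * (cmod (f None))\<^sup>2 else 0) has_sum
            d j * (cmod (f None))\<^sup>2) (V j)"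
          using root_in[OF j] by (intro has_sum_finite_neutralI[of "{\<omega> j}"]) auto
      qed
      also have "?this \<longleftrightarrow> ?thesis"
        using j by (intro has_sum_cong)
          (auto simp: R_Some S_apply h_def d_def norm_mult power_mult_distrib parent_in)
      finally show ?thesis .
    qed
    have Gb: "(ell2_norm (V j) (S j (h j)))\<^sup>2 + d j * (cmod (f None))\<^sup>2 \<le> b j" if j: "j \<in> J" for j
    proof -
      have "ell2_norm (V j) (S j (h j)) \<le> M * ell2_norm (V j) (h j)"
        using op_norm_bound[OF S[OF j] h(1)[OF j]] mult_right_mono[OF M[OF j] ell2_norm_nonneg]
        by (rule order_trans)
      then have "(ell2_norm (V j) (S j (h j)))\<^sup>2 \<le> (M * ell2_norm (V j) (h j))\<^sup>2"
        by (intro power_mono) auto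
      then show ?thesis by (simp add: b_def power_mult_distrib h(2)[OF j])
    qed
    have b: "(b has_sum (M\<^sup>2 * infsum ?F ?U + infsum d J * (cmod (f None))\<^sup>2)) J"
      unfolding b_def
      by (intro has_sum_add has_sum_cmult_left has_sum_cmult_right has_sum_infsum_UN F disjoint
          has_sum_infsum d)
    have GU: "?G summable_on ?U"
    proof (rule summable_on_UnionI[OF G])
      show "(\<lambda>j. (ell2_norm (V j) (S j (h j)))\<^sup>2 + d j * (cmod (f None))\<^sup>2) summable_on J"
        by (rule summable_on_comparison_test[OF has_sum_imp_summable[OF b] Gb]) (auto simp: d_def)
    qed (use disjoint in auto)
    have Rf: "R f \<in> ell2 W"
      unfolding ell2_W_iff using GU by (auto simp: R_def weighted_shift_def)
    have "infsum ?G ?U \<le> M\<^sup>2 * infsum ?F ?U + infsum d J * (cmod (f None))\<^sup>2"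
      using Gb infsumI[OF G] by (intro has_sum_mono[OF has_sum_infsum_UN[OF GU disjoint] b]) auto
    \<comment> \<open>These are the two missing terms in the expansion of the product of
      \<open>M^2 + infsum d J\<close> with the squared norm of \<open>f\<close>.\<close>
    moreover have "0 \<le> infsum d J * infsum ?F ?U" "0 \<le> M\<^sup>2 * (cmod (f None))\<^sup>2"
      by (auto intro!: infsum_nonneg mult_nonneg_nonneg simp: d_def)
    ultimately have "(ell2_norm W (R f))\<^sup>2 \<le> (M\<^sup>2 + infsum d J) * (ell2_norm W f)\<^sup>2"
      unfolding ell2_norm_W[OF Rf] ell2_norm_W[OF f] distrib_left distrib_right
      by (simp only: R_None norm_zero zero_power2 add_0)
    then have "sqrt ((ell2_norm W (R f))\<^sup>2) \<le> sqrt ((M\<^sup>2 + infsum d J) * (ell2_norm W f)\<^sup>2)"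
      by (rule real_sqrt_le_mono)
    with Rf show ?thesis by (simp add: real_sqrt_mult)
  qed
  show ?thesis
    unfolding R_def by (rule bounded_operator_weighted_shiftI) (use * in \<open>auto simp: R_def\<close>)
qed

lemma power_hyponormal_R:
  fixes e :: "'j \<Rightarrow> real"
  assumes R: "bounded_operator W R"
    and c: "\<And>j. j \<in> J \<Longrightarrow> lam' (Some (\<omega> j)) = of_real (e j) * c j"
    and E: "\<And>j. j \<in> J \<Longrightarrow> bounded_operator (W1 j) (E j (c j))"
      "\<And>j. j \<in> J \<Longrightarrow> power_hyponormal (W1 j) (E j (c j))"
    and e: "(\<lambda>j. (e j)\<^sup>2) summable_on J" "(\<Sum>\<^sub>\<infinity>j\<in>J. (e j)\<^sup>2) \<le> 1"
  shows "power_hyponormal W R"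
  unfolding power_hyponormal_iff[OF R]
proof (intro allI impI ballI)
  fix n :: nat and f g
  assume n: "n \<ge> 1" and f: "f \<in> ell2 W" and g: "g \<in> ell2 W"
  let ?U = "\<Union>j\<in>J. V j"
  \<comment> \<open>The value of \<open>f\<close> at \<open>None\<close> does not affect the pairing
    with \<open>(R ^^ n) g\<close>, which is 0 there for positive \<open>n\<close>, and erasing it
    does not increase the norm of the image.\<close>
  define f0 where "f0 = f(None := 0)"
  have f0: "f0 \<in> ell2 W"
    by (rule ell2_dominated[OF f]) (use ell2D(2)[OF f] in \<open>auto simp: f0_def\<close>)
  have restrict: "(R ^^ n) f0 x = 0 \<or> (R ^^ n) f0 x = (R ^^ n) f x" for x
    unfolding R_def using weighted_shift_funpow_restrict[where f' = f0 and f = f]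
    by (simp add: f0_def)
  define q where "q v = 2 * Re ((R ^^ n) g (Some v) * cnj (f (Some v)))" for v
  define a where "a v = (cmod (g (Some v)))\<^sup>2" for v
  define b where "b v = (cmod ((R ^^ n) f0 (Some v)))\<^sup>2" for v
  note Rnl2 = funpow_ell2[OF R]
  have a: "a summable_on ?U" and b: "b summable_on ?U"
    using g Rnl2[OF f0, of n] by (simp_all add: ell2_W_iff a_def[abs_def] b_def[abs_def])
  have Rn_None: "(R ^^ n) g None = 0"
    using n by (cases n) auto
  have "((\<lambda>x. (R ^^ n) g x * cnj (f x)) has_sum ell2_inner W ((R ^^ n) g) f) W"
    unfolding ell2_inner_def by (intro has_sum_infsum ell2_inner_summable f g Rnl2)
  then have "((\<lambda>x. (R ^^ n) g x * cnj (f x)) has_sum ell2_inner W ((R ^^ n) g) f) (Some ` ?U)"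
    by (rule has_sum_cong_neutral[THEN iffD1, rotated -1]) (auto simp: W_def Rn_None)
  then have inner_sum: "((\<lambda>v. (R ^^ n) g (Some v) * cnj (f (Some v))) has_sum ell2_inner W ((R ^^ n) g) f) ?U"
    by (subst (asm) has_sum_reindex) (auto simp: o_def)
  then have q: "(q has_sum 2 * Re (ell2_inner W ((R ^^ n) g) f)) ?U"
    unfolding q_def by (intro has_sum_cmult_right has_sum_Re)
  \<comment> \<open>This is the inequality for the \<open>j\<close>-th extension, written in terms
    of \<open>R\<close>. The common root is charged only the share \<open>(e j)^2\<close> of its
    squared value, so the charges over all \<open>j\<close> stay within the available one.\<close>
  have local: "infsum q (V j) \<le> (e j)\<^sup>2 * (cmod (g None))\<^sup>2 + infsum a (V j) + infsum b (V j)"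
    if j: "j \<in> J" for j
  proof -
    define f' where "f' x = (if x \<in> Some ` V j then f x else 0)" for x
    \<comment> \<open>The factor at \<open>None\<close> compensates for the smaller root weight in
      the sum: with it, powers of the extension applied to \<open>g'\<close> match powers of
      \<open>R\<close> applied to \<open>g\<close> on \<open>V j\<close>.\<close>
    define g' where "g' = (\<lambda>x. if x \<in> W1 j then g x else 0)(None := of_real (e j) * g None)"
    have sub: "V j \<subseteq> ?U" using j by blast
    note aj = summable_on_subset[OF a sub] and bj = summable_on_subset[OF b sub]
    have f': "f' \<in> ell2 (W1 j)"
      using summable_on_subset[OF _ sub, of "\<lambda>v. (cmod (f (Some v)))\<^sup>2"] f
      unfolding ell2_W1_iff ell2_W_iff by (auto simp: f'_def W1_def cong: summable_on_cong)
    have g': "g' \<in> ell2 (W1 j)"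
      using aj unfolding ell2_W1_iff by (auto simp: g'_def a_def W1_def cong: summable_on_cong)
    note El2 = funpow_ell2[OF E(1)[OF j]]
    have Ef: "(E j (c j) ^^ n) f' None = 0" "\<forall>v\<in>V j. (E j (c j) ^^ n) f' (Some v) = (R ^^ n) f0 (Some v)"
      using funpow_E_R[OF j c[OF j], of f' f0 n] n by (cases n; auto simp: f'_def f0_def)+
    have Eg: "\<forall>v\<in>V j. (E j (c j) ^^ n) g' (Some v) = (R ^^ n) g (Some v)"
      using funpow_E_R[OF j c[OF j], of g' g n] by (simp add: g'_def W1_def)
    have "ell2_inner (W1 j) ((E j (c j) ^^ n) g') f'
        = (\<Sum>\<^sub>\<infinity>v\<in>V j. (E j (c j) ^^ n) g' (Some v) * cnj (f' (Some v)))"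
      using ell2_inner_W1[OF El2[OF g'] f'] by (simp add: f'_def)
    also have "\<dots> = (\<Sum>\<^sub>\<infinity>v\<in>V j. (R ^^ n) g (Some v) * cnj (f (Some v)))"
      using Eg by (intro infsum_cong) (simp add: f'_def)
    finally have "2 * Re (ell2_inner (W1 j) ((E j (c j) ^^ n) g') f')
        = 2 * Re (\<Sum>\<^sub>\<infinity>v\<in>V j. (R ^^ n) g (Some v) * cnj (f (Some v)))" by simp
    also have "\<dots> = infsum q (V j)"
    proof -
      have "(\<lambda>v. (R ^^ n) g (Some v) * cnj (f (Some v))) summable_on V j"
        using summable_on_subset[OF has_sum_imp_summable[OF inner_sum] sub] .
      then show ?thesis
        unfolding q_def by (simp only: infsum_Re[symmetric] infsum_cmult_right')
    qed
    finally have "2 * Re (ell2_inner (W1 j) ((E j (c j) ^^ n) g') f') = infsum q (V j)" .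
    moreover have "(ell2_norm (W1 j) g')\<^sup>2 = (e j)\<^sup>2 * (cmod (g None))\<^sup>2 + infsum a (V j)"
      unfolding ell2_norm_W1[OF g'] a_def
      by (intro arg_cong2[where f = "(+)"] infsum_cong)
        (auto simp: g'_def norm_mult power_mult_distrib W1_def)
    moreover have "(ell2_norm (W1 j) ((E j (c j) ^^ n) f'))\<^sup>2 = infsum b (V j)"
      unfolding ell2_norm_W1[OF El2[OF f']] b_def Ef(1)
      using Ef(2) by (auto intro: infsum_cong)
    ultimately show ?thesis
      using E(2)[OF j, unfolded power_hyponormal_iff[OF E(1)[OF j]], rule_format, OF n f' g']
      by simp
  qed
  have "2 * Re (ell2_inner W ((R ^^ n) g) f)
      \<le> (\<Sum>\<^sub>\<infinity>j\<in>J. (e j)\<^sup>2) * (cmod (g None))\<^sup>2 + infsum a ?U + infsum b ?U"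
  proof (rule has_sum_mono)
    show "((\<lambda>j. infsum q (V j)) has_sum 2 * Re (ell2_inner W ((R ^^ n) g) f)) J"
      using has_sum_infsum_UN[OF has_sum_imp_summable[OF q] disjoint] infsumI[OF q] by simp
    show "((\<lambda>j. (e j)\<^sup>2 * (cmod (g None))\<^sup>2 + infsum a (V j) + infsum b (V j)) has_sum
        (\<Sum>\<^sub>\<infinity>j\<in>J. (e j)\<^sup>2) * (cmod (g None))\<^sup>2 + infsum a ?U + infsum b ?U) J"
      by (intro has_sum_add has_sum_cmult_left has_sum_infsum e has_sum_infsum_UN a b disjoint)
  qed (rule local)
  also have "\<dots> \<le> (cmod (g None))\<^sup>2 + infsum a ?U + infsum b ?U"
    using mult_right_mono[OF e(2), of "(cmod (g None))\<^sup>2"] by simp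
  also have "(cmod (g None))\<^sup>2 + infsum a ?U = (ell2_norm W g)\<^sup>2"
    by (simp add: ell2_norm_W[OF g] a_def[abs_def])
  also have "infsum b ?U \<le> (ell2_norm W ((R ^^ n) f))\<^sup>2"
  proof -
    have "infsum b ?U \<le> (ell2_norm W ((R ^^ n) f0))\<^sup>2"
      by (simp add: ell2_norm_W[OF Rnl2[OF f0]] b_def[abs_def])
    also have "\<dots> \<le> (ell2_norm W ((R ^^ n) f))\<^sup>2"
      using restrict ell2D(2)[OF Rnl2[OF f0]]
      by (intro power_mono ell2_dominated[OF Rnl2[OF f]]) (metis norm_ge_zero norm_zero order_refl, auto)
    finally show ?thesis .
  qed
  finally show "2 * Re (ell2_inner W ((R ^^ n) g) f)
      \<le> (ell2_norm W g)\<^sup>2 + (ell2_norm W ((R ^^ n) f))\<^sup>2" by simp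
qed

end

section \<open>Choice of the root weights and proof of the equivalence\<close>

lemma countable_positive_summable:
  assumes "countable J"
  obtains \<delta> :: "'j \<Rightarrow> real" where "\<And>j. 0 < \<delta> j" "\<And>j. \<delta> j \<le> 1" "\<delta> summable_on J" "infsum \<delta> J \<le> 1"
proof -
  \<comment> \<open>The exponent starts at 1, so the series sums to exactly 1. An injective
    enumeration of \<open>J\<close> selects a subseries, whose sum is at most 1.\<close>
  define h where "h n = (1 / 2 :: real) ^ Suc n" for n
  have h: "(h has_sum 1) UNIV"
    unfolding h_def using power_half_series by (intro sums_nonneg_imp_has_sum) auto
  have inj: "inj_on (to_nat_on J) J" using assms by (rule inj_on_to_nat_on)
  have hJ: "h summable_on (to_nat_on J ` J)"
    using summable_on_subset[OF has_sum_imp_summable[OF h]] by blast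
  have "infsum h (to_nat_on J ` J) \<le> infsum h UNIV"
    by (rule infsum_mono2[OF hJ has_sum_imp_summable[OF h]]) (auto simp: h_def)
  then show ?thesis
    using that[of "h \<circ> to_nat_on J"] hJ infsumI[OF h]
    by (auto simp: summable_on_reindex[OF inj] infsum_reindex[OF inj] h_def power_le_one
        simp del: power_Suc)
qed

theorem theorem4p10:
  fixes J :: "'j set"
    and V :: "'j \<Rightarrow> 'a set"
    and p :: "'j \<Rightarrow> 'a \<Rightarrow> 'a"
    and \<omega> :: "'j \<Rightarrow> 'a"
    and lam :: "'a \<Rightarrow> complex"
    and S :: "'j \<Rightarrow> ('a \<Rightarrow> complex) \<Rightarrow> ('a \<Rightarrow> complex)"
  assumes "countable J"
    and "\<And>j. j \<in> J \<Longrightarrow> rooted_directed_tree (V j) (p j)"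
    and "disjoint_family_on V J"
    and "\<And>j. j \<in> J \<Longrightarrow> \<omega> j = tree_root (V j) (p j)"
    and "\<And>j. j \<in> J \<Longrightarrow> S j = weighted_shift (V j) (p j) (lam(\<omega> j := 0))"
    and "\<And>j. j \<in> J \<Longrightarrow> proper_weights (V j) (p j) (lam(\<omega> j := 0))"
    and "\<And>j. j \<in> J \<Longrightarrow> bounded_weighted_shift (V j) (p j) (lam(\<omega> j := 0))"
  shows
    "(\<exists>lam' :: 'a option \<Rightarrow> complex.
        lam' None = 0 \<and>
        (\<forall>j\<in>J. \<forall>v\<in>V j - {\<omega> j}. lam' (Some v) = lam v) \<and>
        proper_weights (rooted_sum_vertices J V) (rooted_sum_parent J V p) lam' \<and>
        bounded_weighted_shift (rooted_sum_vertices J V) (rooted_sum_parent J V p) lam' \<and>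
        power_hyponormal (rooted_sum_vertices J V)
          (weighted_shift (rooted_sum_vertices J V) (rooted_sum_parent J V p) lam'))
     \<longleftrightarrow>
     (bdd_above ((\<lambda>j. op_norm (V j) (S j)) ` J) \<and>
      (\<forall>j\<in>J. admits_power_hyponormal_backward_ext (V j) (p j) (lam(\<omega> j := 0))))"
proof -
  let ?W = "rooted_sum_vertices J V" and ?p = "rooted_sum_parent J V p"
  have root: "is_root (V j) (p j) v \<longleftrightarrow> v = \<omega> j" if "j \<in> J" for j v
    using is_root_iff[OF assms(2)[OF that]] assms(4)[OF that] by simp
  have root_in: "\<omega> j \<in> V j" if "j \<in> J" for j
    using root[OF that, of "\<omega> j"] by (simp add: is_root_def)
  have S: "bounded_operator (V j) (S j)" if "j \<in> J" for j
    using assms(5,7)[OF that] by (simp add: bounded_weighted_shift_def)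
  show ?thesis
  proof (intro iffI; elim exE conjE)
    fix lam' :: "'a option \<Rightarrow> complex"
    assume None: "lam' None = 0"
      and eq: "\<forall>j\<in>J. \<forall>v\<in>V j - {\<omega> j}. lam' (Some v) = lam v"
      and proper: "proper_weights ?W ?p lam'"
      and bounded: "bounded_weighted_shift ?W ?p lam'"
      and power: "power_hyponormal ?W (weighted_shift ?W ?p lam')"
    interpret X: rooted_sum_shift J V p lam lam'
      using assms(2,3,4) None eq by unfold_locales auto
    have XS: "X.S j = S j" if "j \<in> J" for j
      using assms(4,5)[OF that] by (simp add: X.S_def)
    have R: "bounded_operator ?W X.R" "power_hyponormal ?W X.R"
      using bounded power by (simp_all add: X.R_def bounded_weighted_shift_def)
    obtain C where C: "C \<ge> 0" "\<And>f. f \<in> ell2 ?W \<Longrightarrow> ell2_norm ?W (X.R f) \<le> C * ell2_norm ?W f"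
      using bounded_operatorE[OF R(1)] by blast
    have "bdd_above ((\<lambda>j. op_norm (V j) (S j)) ` J)"
      using X.op_norm_S_le[OF _ C] S XS by (intro bdd_aboveI2[where M = C]) simp
    moreover have "admits_power_hyponormal_backward_ext (V j) (p j) (lam(\<omega> j := 0))" if j: "j \<in> J" for j
    proof -
      let ?c = "lam' (Some (\<omega> j))"
      let ?lam1 = "backward_ext_weights (V j) (p j) (lam(\<omega> j := 0)) ?c"
      have "Some (\<omega> j) \<in> ?W" using root_in[OF j] j by (auto simp: X.W_def)
      \<comment> \<open>The new vertex \<open>None\<close> is the only root of the sum, so
        properness forces a nonzero weight at \<open>\<omega> j\<close>. This weight serves for the
        extension.\<close>
      then have "?c \<noteq> 0"
        using proper X.is_root_W_iff[of "Some (\<omega> j)"] by (auto simp: proper_weights_def)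
      moreover have "weight_system (X.W1 j) (backward_ext_parent (V j) (p j)) ?lam1"
        by (simp add: weight_system_def X.is_root_W1_iff[OF j] backward_ext_weights_def)
      moreover have "power_hyponormal (V j) (weighted_shift (V j) (p j) (lam(\<omega> j := 0)))"
        using X.power_hyponormal_S[OF j _ R] S[OF j] XS[OF j] assms(5)[OF j] by simp
      moreover have "bounded_operator (X.W1 j) (X.E j ?c)" "power_hyponormal (X.W1 j) (X.E j ?c)"
        using X.bounded_operator_E[OF j R(1)] X.power_hyponormal_E[OF j _ R] S[OF j] XS[OF j]
          assms(4)[OF j] by simp_all
      ultimately show ?thesis
        unfolding admits_power_hyponormal_backward_ext_def Let_def bounded_weighted_shift_def
        using assms(7)[OF j, unfolded bounded_weighted_shift_def] assms(4)[OF j]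
        unfolding X.E_def by metis
    qed
    ultimately show "bdd_above ((\<lambda>j. op_norm (V j) (S j)) ` J) \<and>
        (\<forall>j\<in>J. admits_power_hyponormal_backward_ext (V j) (p j) (lam(\<omega> j := 0)))" by blast
  next
    assume bdd: "bdd_above ((\<lambda>j. op_norm (V j) (S j)) ` J)"
      and adm: "\<forall>j\<in>J. admits_power_hyponormal_backward_ext (V j) (p j) (lam(\<omega> j := 0))"
    obtain c where c: "\<And>j. j \<in> J \<Longrightarrow> c j \<noteq> 0 \<and>
        bounded_weighted_shift (backward_ext_vertices (V j)) (backward_ext_parent (V j) (p j))
          (backward_ext_weights (V j) (p j) (lam(\<omega> j := 0)) (c j)) \<and>
        power_hyponormal (backward_ext_vertices (V j))
          (weighted_shift (backward_ext_vertices (V j)) (backward_ext_parent (V j) (p j))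
            (backward_ext_weights (V j) (p j) (lam(\<omega> j := 0)) (c j)))"
      using adm unfolding admits_power_hyponormal_backward_ext_def Let_def by metis
    obtain \<delta> :: "'j \<Rightarrow> real" where \<delta>: "\<And>j. 0 < \<delta> j" "\<And>j. \<delta> j \<le> 1" "\<delta> summable_on J" "infsum \<delta> J \<le> 1"
      using countable_positive_summable[OF assms(1)] by blast
    \<comment> \<open>With this denominator both \<open>e j\<close> and
      \<open>e j * cmod (c j)\<close> are \<open>\<delta> j\<close> times a number in the unit
      interval. Their squares are then at most \<open>\<delta> j\<close>, which controls the charges
      at the root and the boundedness of the sum at once.\<close>
    define e where "e j = \<delta> j / (1 + cmod (c j))" for j
    have \<delta>_sq: "(\<delta> j * t)\<^sup>2 \<le> \<delta> j" if "0 \<le> t" "t \<le> 1" for j t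
    proof -
      have "(\<delta> j * t)\<^sup>2 \<le> (\<delta> j)\<^sup>2"
        using \<delta>(1)[of j] that by (intro power_mono mult_left_le) auto
      also have "\<dots> \<le> \<delta> j"
        using \<delta>(1,2)[of j] by (simp add: power2_eq_square mult_left_le)
      finally show ?thesis .
    qed
    have pos: "0 < 1 + cmod (c j)" for j
      by (simp add: add_pos_nonneg)
    have e_sq: "(e j)\<^sup>2 \<le> \<delta> j" for j
      using \<delta>_sq[of "1 / (1 + cmod (c j))" j] pos[of j] by (simp add: e_def)
    have ec_sq: "(e j * cmod (c j))\<^sup>2 \<le> \<delta> j" for j
      using \<delta>_sq[of "cmod (c j) / (1 + cmod (c j))" j] pos[of j] by (simp add: e_def)
    have e_pos: "0 < e j" for j
      using \<delta>(1)[of j] pos[of j] by (simp add: e_def)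
    have index_eq: "j = k" if "j \<in> J" "k \<in> J" "\<omega> k \<in> V j" for j k
      using disjoint_family_onD[OF assms(3) that(1,2)] root_in[OF that(2)] that(3) by blast
    have inj: "inj_on \<omega> J"
      using index_eq root_in by (intro inj_onI) metis
    \<comment> \<open>The index is recovered from the root by \<open>inv_into\<close>, which is
      legitimate since disjoint trees have different roots.\<close>
    define lam' :: "'a option \<Rightarrow> complex" where "lam' = case_option 0
      (\<lambda>v. if v \<in> \<omega> ` J then of_real (e (inv_into J \<omega> v)) * c (inv_into J \<omega> v) else lam v)"
    have None: "lam' None = 0" by (simp add: lam'_def)
    have root_weight: "lam' (Some (\<omega> j)) = of_real (e j) * c j" if "j \<in> J" for j
      using that by (simp add: lam'_def inv_into_f_f[OF inj])
    have eq: "lam' (Some v) = lam v" if "j \<in> J" "v \<in> V j" "v \<noteq> \<omega> j" for j v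
    proof -
      \<comment> \<open>A vertex of \<open>V j\<close> that is the root of some tree in the family
        is by disjointness the root of \<open>V j\<close> itself.\<close>
      have "v \<notin> \<omega> ` J"
        using that index_eq by blast
      then show ?thesis by (simp add: lam'_def)
    qed
    interpret X: rooted_sum_shift J V p lam lam'
      using assms(2,3,4) None eq by unfold_locales auto
    have XS: "X.S j = S j" if "j \<in> J" for j
      using assms(4,5)[OF that] by (simp add: X.S_def)
    have E: "bounded_operator (X.W1 j) (X.E j (c j))" "power_hyponormal (X.W1 j) (X.E j (c j))"
      if "j \<in> J" for j
      using c[OF that] assms(4)[OF that] by (simp_all add: X.E_def bounded_weighted_shift_def)
    obtain M where M: "\<And>j. j \<in> J \<Longrightarrow> op_norm (V j) (S j) \<le> M"
      using bdd unfolding bdd_above_def by blast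
    have R: "bounded_operator ?W X.R"
    proof (rule X.bounded_operator_R)
      show "(\<lambda>j. (cmod (lam' (Some (tree_root (V j) (p j)))))\<^sup>2) summable_on J"
        using ec_sq e_pos root_weight assms(4)
        by (intro summable_on_comparison_test[OF \<delta>(3)]) (auto simp: norm_mult less_imp_le)
    qed (use S M XS in auto)
    have e_summable: "(\<lambda>j. (e j)\<^sup>2) summable_on J"
      using e_sq by (intro summable_on_comparison_test[OF \<delta>(3)]) auto
    have "power_hyponormal ?W X.R"
    proof (rule X.power_hyponormal_R[OF R _ E e_summable])
      show "(\<Sum>\<^sub>\<infinity>j\<in>J. (e j)\<^sup>2) \<le> 1"
        using infsum_mono[OF e_summable \<delta>(3) e_sq] \<delta>(4) by simp
    qed (use root_weight assms(4) in auto)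
    moreover have "proper_weights ?W ?p lam'"
      unfolding proper_weights_def
    proof (intro ballI impI)
      fix x assume x: "x \<in> ?W" "lam' x = 0"
      show "is_root ?W ?p x"
      proof (cases x)
        case (Some v)
        then obtain j where j: "j \<in> J" "v \<in> V j" using x(1) by (auto simp: X.W_def)
        have "v \<noteq> \<omega> j"
          using x(2) Some root_weight[OF j(1)] c[OF j(1)] e_pos[of j] by auto
        moreover from this have "lam v = 0" using x(2) Some eq[OF j] by simp
        ultimately show ?thesis
          using assms(6)[OF j(1)] root[OF j(1), of v] j(2) by (auto simp: proper_weights_def)
      qed (simp add: X.is_root_W_iff)
    qed
    moreover have "weight_system ?W ?p lam'"
      by (simp add: weight_system_def X.is_root_W_iff None)
    ultimately show "\<exists>lam' :: 'a option \<Rightarrow> complex. lam' None = 0 \<and>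
        (\<forall>j\<in>J. \<forall>v\<in>V j - {\<omega> j}. lam' (Some v) = lam v) \<and>
        proper_weights ?W ?p lam' \<and> bounded_weighted_shift ?W ?p lam' \<and>
        power_hyponormal ?W (weighted_shift ?W ?p lam')"
      using None eq R unfolding bounded_weighted_shift_def X.R_def by (intro exI[of _ lam']) auto
  qed
qed

end
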